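(* Let $\mathcal{X}=\{0,1\}$, let $X\sim\mathrm{Bern}(p)$ with the convention $P_X(0)=p$, and consider lossless recovery (distortion level $\mathsf{d}=0$) with achievable rate region $\mathcal{R}$. Let $\mathscr{U}:\mathcal{X}\times\mathcal{X}\to\mathbb{R}$ be the sender's utility, with $\mathscr{U}(0,0)=\mathscr{U}(1,1)=0$. Then $\mathcal{R}\neq\emptyset$ if and only if $$\mathscr{U}(0,1)+\mathscr{U}(1,0)<0 .$$ Further: (a) If $\mathscr{U}(0,1)+\mathscr{U}(1,0)\ge 0$, then for small enough $\delta>0$, $\max_{s_n\in\mathscr{B}(g_n)}\mathcal{E}_\delta(g_n,s_n)\to 1$ for all sequences of receiver strategies $\{g_n\}_{n\ge1}$. (b) If $\mathscr{U}(0,1)+\mathscr{U}(1,0)<0$ and either $\mathscr{U}(0,1)\ge 0$ or $\mathscr{U}(1,0)\ge 0$, then $$\mathcal{R}^{\inf}=H(p),\qquad \mathcal{R}^{\sup}\le H\Big(\min\Big\{\frac{b}{a}p,\frac12\Big\}\Big),$$ where $a=\min\{|\mathscr{U}(0,1)|,|\mathscr{U}(1,0)|\}$ and $b=\max\{|\mathscr{U}(0,1)|,|\mathscr{U}(1,0)|\}$. Moreover, if $\mathscr{U}(1,0)=-b$ and $\mathscr{U}(0,1)=a$, then for receiver strategies $g_n$ such that $\lim_{n\to\infty}\frac1n\log|\mathrm{Im}(g_n)|>H(\min\{\frac{b}{a}p,\frac12\})$, and for small enough $\delta>0$, $$\lim_{n\to\infty}\max_{s_n\in\mathscr{B}(g_n)}\mathcal{E}_\delta(g_n,s_n)=1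 .$$ (c) If $\mathscr{U}(0,1)<0$ and $\mathscr{U}(1,0)<0$, then $\mathcal{R}=[H(p),1]$.
   Context: All logarithms are base 2 and $H(t)=-t\log t-(1-t)\log(1-t)$ is the binary entropy. Setting. $\mathcal{X}$ is a finite alphabet, $P_X$ a probability distribution on $\mathcal{X}$, and the source sequence $\mathbf X=(X_1,\dots,X_n)$ has i.i.d. $P_X$ components. A sender strategy is a function $s_n:\mathcal{X}^n\to\mathcal{X}^n$; a receiver strategy is a function $g_n:\mathcal{X}^n\to\mathcal{X}^n$ (both deterministic). The normalized Hamming distance is $d_n(\hat x,x)=\frac1n|\{k:\hat x_k\ne x_k\}|$. The sender's $n$-block utility is $\mathscr{U}_n(\hat x,x)=\frac1n\sum_{i=1}^n\mathscr{U}(\hat x_i,x_i)$, where the first argument is the recovered sequence and the second the observed one. Best responses: $\mathscr{B}(g_n)$ is the set of all $s_n$ such that $\mathscr{U}_n(g_n(s_n(x)),x)\ge \mathscr{U}_n(g_n(s_n'(x)),x)$ for all $x\in\mathcal{X}^n$ and all sender strategies $s_n'$. For a distortion level $\mathsf{d}$: $\mathcal{D}_{\mathsf d}(g_n,s_n)=\{x\in\mathcal{X}^n: d_n(g_n(s_n(x)),x)\le\mathsf{d}\}$; probability of error $\mathcal{E}_{\mathsf d}(g_n,s_n)=1-\mathbb{P}(\mathbf X\in\mathcal{D}_{\mathsf d}(g_n,s_n))$; worst-case best responses $\mathscr{S}_{\mathsf d}(g_n)=\arg\max_{s_n\in\mathscr{B}(g_n)}\mathcal{E}_{\mathsf d}(g_n,s_n)$;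 $\mathcal{A}^n_{\mathsf d}(g_n,s_n)=\{\hat x\in\mathrm{Im}(g_n):\exists x\in\mathcal{D}_{\mathsf d}(g_n,s_n),\ g_n(s_n(x))=\hat x\}$; rate $R_{\mathsf d}(g_n,s_n)=\frac1n\log|\mathcal{A}^n_{\mathsf d}(g_n,s_n)|$. A rate $R$ is achievable at level $\mathsf{d}$ if there exist receiver strategies $\{g_n\}_{n\ge1}$, $s_n\in\mathscr{S}_{\mathsf d+\delta_n}(g_n)$, and sequences $\epsilon_n,\delta_n\to0$ such that $\mathcal{E}_{\mathsf d+\delta_n}(g_n,s_n)<\epsilon_n$ and $\lim_{n\to\infty}R_{\mathsf d+\delta_n}(g_n,s_n)=R$. For $\mathsf d=0$ (lossless recovery) the set of achievable rates is denoted $\mathcal{R}$, with $\mathcal{R}^{\inf}=\inf\mathcal{R}$ and $\mathcal{R}^{\sup}=\sup\mathcal{R}$.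
   Formalization: Proved for 0 < p < 1: for p = 0 or 1 the source is constant, a constant receiver achieves rate 0 for every utility, and the equivalence and (a) fail. When a = 0, b/a is read as +∞, so min{(b/a)p, 1/2} = 1/2. *)

theory Defs
  imports "HOL-Probability.Probability" "HOL-Library.Z2"
begin

(* The binary alphabet {0,1} is the type bit of HOL-Library.Z2, used only for its elements 0 and 1. *)

instance bit :: finite
proof
  have "(UNIV :: bit set) \<subseteq> {0, 1}" by auto
  then show "finite (UNIV :: bit set)" by (rule finite_subset) simp
qed

(* The convention 0 log 0 = 0 holds automatically, since 0 * c = 0. *)
definition binary_entropy :: "real \<Rightarrow> real" where
  "binary_entropy t = - t * log 2 t - (1 - t) * log 2 (1 - t)"

definition blocks :: "nat \<Rightarrow> 'a::finite list set" where
  "blocks n = {x. length x = n}"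

(* Sender and receiver strategies are both maps from n-blocks to n-blocks. The extensional
   function space makes the set of strategies finite, so that the maxima below are attained. *)
definition strategies :: "nat \<Rightarrow> ('a::finite list \<Rightarrow> 'a list) set" where
  "strategies n = blocks n \<rightarrow>\<^sub>E blocks n"

definition hamming_dist :: "nat \<Rightarrow> 'a::finite list \<Rightarrow> 'a list \<Rightarrow> real" where
  "hamming_dist n y x = real (card {k. k < n \<and> y ! k \<noteq> x ! k}) / real n"

(* In utilities the first argument is the recovered symbol or block, the second the observed one. *)
definition block_utility ::
    "('a::finite \<Rightarrow> 'a \<Rightarrow> real) \<Rightarrow> nat \<Rightarrow> 'a list \<Rightarrow> 'a list \<Rightarrow> real" where
  "block_utility U n y x = (\<Sum>i<n. U (y ! i) (x ! i)) / real n"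

definition best_responses ::
    "('a::finite \<Rightarrow> 'a \<Rightarrow> real) \<Rightarrow> nat \<Rightarrow> ('a list \<Rightarrow> 'a list) \<Rightarrow> ('a list \<Rightarrow> 'a list) set" where
  "best_responses U n g = {s \<in> strategies n. \<forall>x \<in> blocks n. \<forall>s' \<in> strategies n.
     block_utility U n (g (s x)) x \<ge> block_utility U n (g (s' x)) x}"

definition recovered_set ::
    "nat \<Rightarrow> real \<Rightarrow> ('a::finite list \<Rightarrow> 'a list) \<Rightarrow> ('a list \<Rightarrow> 'a list) \<Rightarrow> 'a list set" where
  "recovered_set n d g s = {x \<in> blocks n. hamming_dist n (g (s x)) x \<le> d}"

(* replicate_pmf n P is the law of n i.i.d. symbols with distribution P. *)
definition error_prob ::
    "'a::finite pmf \<Rightarrow> nat \<Rightarrow> real \<Rightarrow> ('a list \<Rightarrow> 'a list) \<Rightarrow> ('a list \<Rightarrow> 'a list) \<Rightarrow> real" where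
  "error_prob P n d g s = 1 - measure_pmf.prob (replicate_pmf n P) (recovered_set n d g s)"

definition worst_responses ::
    "('a::finite \<Rightarrow> 'a \<Rightarrow> real) \<Rightarrow> 'a pmf \<Rightarrow> nat \<Rightarrow> real \<Rightarrow> ('a list \<Rightarrow> 'a list) \<Rightarrow>
      ('a list \<Rightarrow> 'a list) set" where
  "worst_responses U P n d g =
     {s. is_arg_max (error_prob P n d g) (\<lambda>s. s \<in> best_responses U n g) s}"

definition worst_error ::
    "('a::finite \<Rightarrow> 'a \<Rightarrow> real) \<Rightarrow> 'a pmf \<Rightarrow> nat \<Rightarrow> real \<Rightarrow> ('a list \<Rightarrow> 'a list) \<Rightarrow> real" where
  "worst_error U P n d g = (MAX s \<in> best_responses U n g. error_prob P n d g s)"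

definition recovered_image ::
    "nat \<Rightarrow> real \<Rightarrow> ('a::finite list \<Rightarrow> 'a list) \<Rightarrow> ('a list \<Rightarrow> 'a list) \<Rightarrow> 'a list set" where
  "recovered_image n d g s = {y \<in> g ` blocks n. \<exists>x \<in> recovered_set n d g s. g (s x) = y}"

(* For an empty recovered image the value is 0, as log 2 0 = 0 in HOL. This does not affect
   achievable rates: there the error probability tends to 0, so the image is eventually nonempty. *)
definition rate ::
    "nat \<Rightarrow> real \<Rightarrow> ('a::finite list \<Rightarrow> 'a list) \<Rightarrow> ('a list \<Rightarrow> 'a list) \<Rightarrow> real" where
  "rate n d g s = log 2 (real (card (recovered_image n d g s))) / real n"

definition achievable ::
    "('a::finite \<Rightarrow> 'a \<Rightarrow> real) \<Rightarrow> 'a pmf \<Rightarrow> real \<Rightarrow> real \<Rightarrow> bool" where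
  "achievable U P d R \<longleftrightarrow>
     (\<exists>(g :: nat \<Rightarrow> 'a list \<Rightarrow> 'a list) (s :: nat \<Rightarrow> 'a list \<Rightarrow> 'a list)
        (\<epsilon> :: nat \<Rightarrow> real) (\<delta> :: nat \<Rightarrow> real).
        (\<forall>n\<ge>1. g n \<in> strategies n \<and>
               s n \<in> worst_responses U P n (d + \<delta> n) (g n) \<and>
               error_prob P n (d + \<delta> n) (g n) (s n) < \<epsilon> n) \<and>
        \<epsilon> \<longlonglongrightarrow> 0 \<and> \<delta> \<longlonglongrightarrow> 0 \<and>
        (\<lambda>n. rate n (d + \<delta> n) (g n) (s n)) \<longlonglongrightarrow> R)"

definition achievable_rates ::
    "('a::finite \<Rightarrow> 'a \<Rightarrow> real) \<Rightarrow> 'a pmf \<Rightarrow> real \<Rightarrow> real set" where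
  "achievable_rates U P d = {R. achievable U P d R}"

(* min {(b/a) p, 1/2} with b/a = \<infinity> for a = 0; the HOL convention b / 0 = 0 would give 0 instead. *)
definition scaled_prob :: "real \<Rightarrow> real \<Rightarrow> real \<Rightarrow> real" where
  "scaled_prob a b p = (if a = 0 then 1 / 2 else min (b / a * p) (1 / 2))"

end

theory Submission
  imports Defs "HOL-Real_Asymp.Real_Asymp"
begin

text \<open>
  The utility of a recovered block \<open>y\<close> for \<open>x\<close> is \<open>\<Sum> (U(0,1) x\<^sub>i + U(1,0) y\<^sub>i - (U(0,1) + U(1,0)) x\<^sub>i y\<^sub>i)\<close>.
  Adding the optimality conditions of two recovered blocks \<open>x, x'\<close> (recovered as \<open>y, y'\<close>) gives
  \<open>(U(0,1) + U(1,0)) \<Sum> (x\<^sub>i - x'\<^sub>i)(y\<^sub>i - y'\<^sub>i) \<le> 0\<close>. If the sum of utilities is positive, this confines all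
  recovered blocks to a small Hamming ball, which has vanishing probability; if it is zero, the
  sender is indifferent between the optimal words and a worst response does the same.

  If the sum is negative, let the receiver use the words with exactly \<open>\<lfloor>pn\<rfloor>\<close> zeros. For
  these the number of zeros is fixed, so best responses are exactly the nearest words, and \<open>H(p)\<close> is
  achieved. No smaller rate is possible because small balls around fewer words cover too
  little probability. If both utilities are negative, further words may be added to the code
  without disturbing recovery, which gives every rate up to \<open>1\<close>.

  In the mixed case write \<open>Z\<close> for the fraction of zeros. Comparing the word \<open>y\<close> of a recovered block
  with that of a typical recovered block \<open>x\<close> gives \<open>a Z(y) \<le> b Z(x) \<approx> b p\<close>, for either sign
  pattern, and there are at most \<open>2\<close> to the power \<open>n H(q)\<close> words with \<open>Z \<le> q \<le> 1/2\<close>.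
\<close>

section \<open>Counting and concentration for binary blocks\<close>

text \<open>The type of a binary block: for given \<open>n\<close>, the probability of a block under
  an i.i.d. source depends on it alone.\<close>

definition zero_freq :: "nat \<Rightarrow> bit list \<Rightarrow> real" where
  "zero_freq n x = real (card {i. i < n \<and> x ! i = 0}) / real n"

lemma finite_blocks [simp]: "finite (blocks n :: 'a::finite list set)"
  using finite_lists_length_eq[of "UNIV :: 'a set" n] by (simp add: blocks_def)

lemma card_blocks_bit: "card (blocks n :: bit list set) = 2 ^ n"
proof -
  have u: "(UNIV :: bit set) = {0, 1}" by auto
  have "card {xs :: bit list. set xs \<subseteq> UNIV \<and> length xs = n} = card (UNIV :: bit set) ^ n"
    by (rule card_lists_length_eq) simp
  moreover have "card (UNIV :: bit set) = 2" by (simp add: u)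
  ultimately show ?thesis by (simp add: blocks_def)
qed

section \<open>Probability of a single block and concentration of its type\<close>

lemma zeros_eq_count: "x \<in> blocks n \<Longrightarrow> card {i. i < n \<and> x ! i = 0} = length (filter (\<lambda>b. b = 0) x)"
  by (auto simp: length_filter_conv_card blocks_def)

lemma pmf_one: "pmf (P :: bit pmf) 1 = 1 - pmf P 0"
proof -
  have "(\<Sum>x\<in>{0, 1::bit}. pmf P x) = 1" by (rule sum_pmf_eq_1) auto
  then show ?thesis by simp
qed

lemma pmf_replicate_Cons:
  "pmf (replicate_pmf (Suc n) P) (c # x) = pmf P c * pmf (replicate_pmf n P) x"
proof -
  have "replicate_pmf (Suc n) P = map_pmf (\<lambda>(c, x). c # x) (pair_pmf P (replicate_pmf n P))"
    by (simp add: pair_pmf_def map_pmf_def bind_assoc_pmf bind_return_pmf)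
  then have "pmf (replicate_pmf (Suc n) P) (c # x)
     = pmf (map_pmf (\<lambda>(c, x). c # x) (pair_pmf P (replicate_pmf n P))) ((\<lambda>(c, x). c # x) (c, x))"
    by simp
  also have "\<dots> = pmf (pair_pmf P (replicate_pmf n P)) (c, x)"
    by (rule pmf_map_inj') (auto simp: inj_def)
  finally show ?thesis by (simp add: pmf_pair)
qed

lemma pmf_replicate_bit:
  fixes P :: "bit pmf"
  shows "pmf (replicate_pmf (length x) P) x
    = pmf P 0 ^ length (filter (\<lambda>b. b = 0) x) * (1 - pmf P 0) ^ length (filter (\<lambda>b. b = 1) x)"
proof (induction x)
  case (Cons c x)
  then show ?case
    by (cases c) (simp_all add: pmf_replicate_Cons pmf_one del: replicate_pmf.simps)
qed simp

text \<open>With k zeros the probability is p^k (1-p)^(n-k), whose exponent is affine in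
  \<open>zero_freq\<close> and equals -n H(p) at frequency p. This centred form serves both the
  estimate for typical blocks and the monotone estimate behind the counting bounds.\<close>

lemma pmf_block:
  fixes P :: "bit pmf"
  assumes p: "0 < p" "p < 1" and P: "pmf P 0 = p" and n: "n \<ge> 1" and x: "x \<in> blocks n"
  shows "pmf (replicate_pmf n P) x
    = 2 powr (n * ((zero_freq n x - p) * (log 2 p - log 2 (1 - p)) - binary_entropy p))"
proof -
  define k where "k = length (filter (\<lambda>b. b = 0) x)"
  have len: "length x = n" using x by (simp add: blocks_def)
  have kn: "k \<le> n" using length_filter_le[of "\<lambda>b. b = 0" x] len by (simp add: k_def)
  have m: "length (filter (\<lambda>b. b = 1) x) = n - k"
    using sum_length_filter_compl[of "\<lambda>b::bit. b = 0" x] len by (simp add: k_def)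
  have z: "zero_freq n x = real k / n" using x by (simp add: zero_freq_def zeros_eq_count k_def)
  have e: "n * ((zero_freq n x - p) * (log 2 p - log 2 (1 - p)) - binary_entropy p)
    = real k * log 2 p + real (n - k) * log 2 (1 - p)"
    using n kn by (simp add: z binary_entropy_def of_nat_diff field_simps)
  have "pmf (replicate_pmf n P) x = p ^ k * (1 - p) ^ (n - k)"
    using pmf_replicate_bit[of x P] len P m by (simp add: k_def)
  also have "\<dots> = 2 powr (log 2 p * real k) * 2 powr (log 2 (1 - p) * real (n - k))"
    using p unfolding powr_powr[symmetric] by (simp add: powr_realpow)
  finally show ?thesis unfolding e by (simp add: powr_add mult.commute)
qed

lemma map_replicate_pmf: "map_pmf (map f) (replicate_pmf n P) = replicate_pmf n (map_pmf f P)"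
proof (induction n)
  case (Suc n)
  show ?case
    unfolding replicate_pmf.simps Suc.IH[symmetric]
    by (simp add: map_pmf_def bind_assoc_pmf bind_return_pmf)
qed simp

text \<open>The indicators of a zero are independent Bernoulli trials, so the number of zeros is
  binomial and Hoeffding's inequality \<open>prob_abs_ge'\<close> applies.\<close>

lemma zero_freq_concentration:
  fixes P :: "bit pmf"
  assumes P: "pmf P 0 = p" and n: "n \<ge> 1" and t: "t \<ge> 0"
  shows "measure_pmf.prob (replicate_pmf n P) {x \<in> blocks n. \<bar>zero_freq n x - p\<bar> \<ge> t}
     \<le> 2 * exp (- 2 * real n * t\<^sup>2)"
proof -
  have p: "p \<in> {0..1}" using P pmf_nonneg[of P 0] pmf_le_1[of P 0] by auto
  have B: "bernoulli_pmf p = map_pmf (\<lambda>b. b = 0) P"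
  proof (rule pmf_eqI)
    fix c :: bool
    have "(\<lambda>b::bit. b = 0) -` {True} = {0}" "(\<lambda>b::bit. b = 0) -` {False} = {1}" by auto
    then show "pmf (bernoulli_pmf p) c = pmf (map_pmf (\<lambda>b. b = 0) P) c"
      using p P by (cases c) (simp_all add: pmf_map measure_pmf_single pmf_one)
  qed
  have "binomial_pmf n p = map_pmf (length \<circ> filter id \<circ> map (\<lambda>b. b = 0)) (replicate_pmf n P)"
    using p by (simp add: binomial_pmf_altdef B map_replicate_pmf[symmetric] pmf.map_comp)
  also have "length \<circ> filter id \<circ> map (\<lambda>b::bit. b = 0) = (\<lambda>x. length (filter (\<lambda>b. b = 0) x))"
    by (simp add: fun_eq_iff filter_map o_def)
  finally have bin: "binomial_pmf n p = map_pmf (\<lambda>x. length (filter (\<lambda>b. b = 0) x)) (replicate_pmf n P)" .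
  interpret binomial_distribution n p by unfold_locales (rule p)
  have "measure_pmf.prob (replicate_pmf n P) {x \<in> blocks n. \<bar>zero_freq n x - p\<bar> \<ge> t}
    \<le> measure_pmf.prob (replicate_pmf n P)
        ((\<lambda>x. length (filter (\<lambda>b. b = 0) x)) -` {k. \<bar>real k / n - p\<bar> \<ge> t})"
    by (rule measure_pmf.finite_measure_mono) (auto simp: zero_freq_def zeros_eq_count)
  also have "\<dots> = measure_pmf.prob (binomial_pmf n p) {k. \<bar>real k / n - p\<bar> \<ge> t}"
    unfolding bin by simp
  also have "\<dots> \<le> 2 * exp (- 2 * real n * t\<^sup>2)"
    using prob_abs_ge'[of t] n t by simp
  finally show ?thesis .
qed

lemma prob_blocks: "measure_pmf.prob (replicate_pmf n P) (blocks n) = 1"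
  by (subst measure_pmf.prob_eq_1) (auto simp: AE_measure_pmf_iff set_replicate_pmf blocks_def)

section \<open>Counting by probability: words with few zeros, Hamming balls, small sets\<close>

text \<open>A change of measure: under the source \<open>Q\<close> with zero probability q every
  counted word has probability at least 2^(-n H(q)), and these probabilities add up to at most
  1.\<close>

lemma card_zero_freq_le:
  assumes q: "0 < q" "q \<le> 1 / 2" and n: "n \<ge> 1"
  shows "card {x \<in> blocks n. zero_freq n x \<le> q} \<le> 2 powr (n * binary_entropy q)"
proof -
  define Q :: "bit pmf" where "Q = map_pmf (\<lambda>b. if b then 0 else 1) (bernoulli_pmf q)"
  have "(\<lambda>b. if b then 0 else (1::bit)) -` {0} = {True}" by (auto split: if_splits)
  then have Q: "pmf Q 0 = q" using q by (simp add: Q_def pmf_map measure_pmf_single)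
  let ?S = "{x \<in> blocks n. zero_freq n x \<le> q}"
  have l: "log 2 q - log 2 (1 - q) \<le> 0" using q by simp
  \<comment> \<open>The log-likelihood is affine in the number of zeros and decreasing, as \<open>q \<le> 1/2\<close>, with value \<open>-n H(q)\<close> at \<open>q n\<close> zeros.\<close>
  have low: "2 powr (- (n * binary_entropy q)) \<le> pmf (replicate_pmf n Q) x" if "x \<in> ?S" for x
  proof -
    have "(zero_freq n x - q) * (log 2 q - log 2 (1 - q)) \<ge> 0"
      using that l by (intro mult_nonpos_nonpos) auto
    then have "real n * (zero_freq n x - q) * (log 2 q - log 2 (1 - q)) \<ge> 0" 
      by (metis mult.assoc mult_nonneg_nonneg of_nat_0_le_iff)
    then show ?thesis using that q by (subst pmf_block[OF _ _ Q n]) (auto simp: algebra_simps)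
  qed
  have fin: "finite ?S" by (rule finite_subset[OF _ finite_blocks]) auto
  have "card ?S * 2 powr (- (n * binary_entropy q)) = (\<Sum>x\<in>?S. 2 powr (- (n * binary_entropy q)))" by simp
  also have "\<dots> \<le> (\<Sum>x\<in>?S. pmf (replicate_pmf n Q) x)" by (intro sum_mono low)
  also have "\<dots> = measure_pmf.prob (replicate_pmf n Q) ?S"
    using fin by (simp add: measure_measure_pmf_finite)
  also have "\<dots> \<le> 1" by simp
  finally show ?thesis by (simp add: powr_minus field_simps)
qed

text \<open>Recode x by its pattern of agreement with y, writing 0 for a disagreement. Distance
  becomes the frequency of zeros, and over a binary alphabet the pattern together with y determines
  x, so the previous count applies.\<close>

lemma card_hamming_ball:
  fixes y :: "bit list"
  assumes q: "0 < q" "q \<le> 1 / 2" and n: "n \<ge> 1" and y: "y \<in> blocks n"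
  shows "card {x \<in> blocks n. hamming_dist n y x \<le> q} \<le> 2 powr (n * binary_entropy q)"
proof -
  let ?f = "\<lambda>x. map (\<lambda>i. if x ! i = y ! i then 1 else 0 :: bit) [0..<n]"
  let ?B = "{x \<in> blocks n. hamming_dist n y x \<le> q}"
  let ?S = "{x \<in> blocks n. zero_freq n x \<le> q}"
  have "inj_on ?f ?B"
  proof (rule inj_onI)
    fix x x' assume x: "x \<in> ?B" "x' \<in> ?B" "?f x = ?f x'"
    have "x ! i = x' ! i" if "i < n" for i
    proof -
      have "?f x ! i = ?f x' ! i" by (rule arg_cong[OF x(3)])
      then have "x ! i = y ! i \<longleftrightarrow> x' ! i = y ! i" using that by (auto split: if_splits)
      then show ?thesis by (cases "x ! i"; cases "x' ! i"; cases "y ! i") auto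
    qed
    then show "x = x'" using x by (auto simp: blocks_def intro: nth_equalityI)
  qed
  moreover have "?f ` ?B \<subseteq> ?S"
  proof -
    have "zero_freq n (?f x) = hamming_dist n y x" for x
    proof -
      have "{i. i < n \<and> ?f x ! i = 0} = {i. i < n \<and> y ! i \<noteq> x ! i}" by (auto split: if_splits)
      then show ?thesis unfolding zero_freq_def hamming_dist_def by (simp only:)
    qed
    then show ?thesis by (auto simp: blocks_def)
  qed
  moreover have "finite ?S" by (rule finite_subset[OF _ finite_blocks]) auto
  ultimately have "card ?B \<le> card ?S" by (rule card_inj_on_le)
  then show ?thesis using card_zero_freq_le[OF q n] by linarith
qed

text \<open>Blocks with frequency near p have probability at most 2^(-n (H(p) - \<eta>/2)), so 2^(n
  (H(p) - \<eta>)) of them carry at most 2^(-n \<eta>/2). All other blocks together are negligible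
  by concentration. The threshold for n is the same for all S.\<close>

lemma prob_small_set:
  fixes P :: "bit pmf"
  assumes p: "0 < p" "p < 1" and P: "pmf P 0 = p" and \<eta>: "\<eta> > 0" and e: "e > 0"
  shows "\<forall>\<^sub>F n in sequentially. \<forall>S \<subseteq> blocks n. card S \<le> 2 powr (n * (binary_entropy p - \<eta>)) \<longrightarrow>
           measure_pmf.prob (replicate_pmf n P) S \<le> e"
proof -
  define L where "L = \<bar>log 2 p - log 2 (1 - p)\<bar>"
  \<comment> \<open>A deviation below t changes the exponent per symbol by at most t L \<le>
    \<eta>/2. The summand 1 keeps the denominator positive when L = 0, that is, for p = 1/2.\<close>
  define t where "t = \<eta> / (2 * (L + 1))"
  have L: "L \<ge> 0" by (simp add: L_def)
  have t: "t > 0" using \<eta> L by (simp add: t_def)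
  have tL: "t * L \<le> \<eta> / 2" using \<eta> L by (simp add: t_def field_simps)
  have lim: "(\<lambda>n::nat. k * exp (- (real n * c))) \<longlonglongrightarrow> 0" if "c > 0" for c k :: real
    using that by real_asymp
  have "(\<lambda>n::nat. 2 * exp (- (real n * (2 * t\<^sup>2))) + 1 * exp (- (real n * (\<eta> / 2 * ln 2)))) \<longlonglongrightarrow> 0 + 0"
    using t \<eta> by (intro tendsto_add lim) auto
  then have "(\<lambda>n::nat. 2 * exp (- 2 * real n * t\<^sup>2) + 2 powr (- (n * (\<eta> / 2)))) \<longlonglongrightarrow> 0"
    by (simp add: powr_def mult_ac)
  then have "\<forall>\<^sub>F n::nat in sequentially. 2 * exp (- 2 * real n * t\<^sup>2) + 2 powr (- (n * (\<eta> / 2))) < e"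
    using e by (rule order_tendstoD)
  then show ?thesis using eventually_ge_at_top[of 1]
  proof eventually_elim
    case (elim n)
    show ?case
    proof (intro allI impI)
      fix S :: "bit list set" assume S: "S \<subseteq> blocks n" and c: "card S \<le> 2 powr (n * (binary_entropy p - \<eta>))"
      have finS: "finite S" using S finite_subset finite_blocks by blast
      let ?M = "measure_pmf.prob (replicate_pmf n P)"
      let ?A = "{x \<in> blocks n. \<bar>zero_freq n x - p\<bar> \<ge> t}"
      have up: "pmf (replicate_pmf n P) x \<le> 2 powr (n * (\<eta> / 2 - binary_entropy p))" if "x \<in> S - ?A" for x
      proof -
        have "(zero_freq n x - p) * (log 2 p - log 2 (1 - p)) \<le> \<bar>zero_freq n x - p\<bar> * L"
          unfolding L_def by (metis abs_ge_self abs_mult)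
        also have "\<dots> \<le> t * L" using that S L by (intro mult_right_mono) auto
        finally show ?thesis using that S tL by (subst pmf_block[OF p P elim(2)]) (auto intro!: mult_left_mono)
      qed
      have "?M S \<le> ?M (?A \<union> (S - ?A))" by (rule measure_pmf.finite_measure_mono) auto
      also have "\<dots> \<le> ?M ?A + ?M (S - ?A)" by (rule measure_Un_le) auto
      also have "?M ?A \<le> 2 * exp (- 2 * real n * t\<^sup>2)"
        using zero_freq_concentration[OF P elim(2)] t by simp
      also have "?M (S - ?A) \<le> 2 powr (- (n * (\<eta> / 2)))"
      proof -
        have "?M (S - ?A) = (\<Sum>x\<in>S - ?A. pmf (replicate_pmf n P) x)"
          using finS by (simp add: measure_measure_pmf_finite)
        also have "\<dots> \<le> (\<Sum>x\<in>S - ?A. 2 powr (n * (\<eta> / 2 - binary_entropy p)))" by (intro sum_mono up)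
        also have "\<dots> = card (S - ?A) * 2 powr (n * (\<eta> / 2 - binary_entropy p))" by simp
        also have "\<dots> \<le> card S * 2 powr (n * (\<eta> / 2 - binary_entropy p))"
          using finS by (intro mult_right_mono) (auto intro: card_mono)
        also have "\<dots> \<le> 2 powr (n * (binary_entropy p - \<eta>)) * 2 powr (n * (\<eta> / 2 - binary_entropy p))"
          using c by (intro mult_right_mono) auto
        also have "\<dots> = 2 powr (- (n * (\<eta> / 2)))"
          by (simp add: powr_add[symmetric] algebra_simps)
        finally show ?thesis .
      qed
      finally show "?M S \<le> e" using elim(1) by simp
    qed
  qed
qed

section \<open>Entropy of small radii and the covering bound\<close>

lemma tendsto_binary_entropy_0: "(binary_entropy \<longlongrightarrow> 0) (at_right 0)"
  unfolding binary_entropy_def log_def by real_asymp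

lemma isCont_binary_entropy: "0 < q \<Longrightarrow> q < 1 \<Longrightarrow> isCont binary_entropy q"
  unfolding binary_entropy_def by (intro continuous_intros) auto

lemma binary_entropy_half: "binary_entropy (1 / 2) = 1"
  by (simp add: binary_entropy_def log_divide)

lemma binary_entropy_pos:
  assumes "0 < p" "p < 1" shows "binary_entropy p > 0"
proof -
  have "p * log 2 p < 0" "(1 - p) * log 2 (1 - p) < 0" using assms by (auto intro!: mult_pos_neg)
  then show ?thesis by (simp add: binary_entropy_def)
qed

lemma small_radius:
  assumes "\<eta> > 0"
  obtains r where "0 < r" "r \<le> 1 / 2" "binary_entropy r < \<eta>"
proof -
  have "\<forall>\<^sub>F r in at_right 0. binary_entropy r < \<eta>"
    using order_tendstoD(2)[OF tendsto_binary_entropy_0 assms] .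
  then obtain b where b: "b > 0" "\<And>r. 0 < r \<Longrightarrow> r < b \<Longrightarrow> binary_entropy r < \<eta>"
    unfolding eventually_at_right_field by auto
  show thesis by (rule that[of "min (b / 2) (1 / 2)"]) (use b in \<open>auto simp: min_def\<close>)
qed

text \<open>The converse of source coding at small distortion: fewer than 2^(n (H(p) - \<eta>))
  balls of radius r with H(r) < \<eta>/2 contain at most 2^(n (H(p) - \<eta>/2)) blocks. By
  \<open>prob_small_set\<close> these eventually have probability at most 1/3, short of the required
  1/2.\<close>

lemma covering_card:
  fixes P :: "bit pmf"
  assumes p: "0 < p" "p < 1" and P: "pmf P 0 = p" and \<eta>: "\<eta> > 0"
  obtains r where "r > 0"
    "\<forall>\<^sub>F n in sequentially. \<forall>A S. A \<subseteq> blocks n \<longrightarrow> S \<subseteq> blocks n \<longrightarrow>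
       (\<forall>x\<in>S. \<exists>y\<in>A. hamming_dist n y x \<le> r) \<longrightarrow> measure_pmf.prob (replicate_pmf n P) S \<ge> 1 / 2 \<longrightarrow>
       card A \<ge> 2 powr (n * (binary_entropy p - \<eta>))"
proof -
  obtain r where r: "0 < r" "r \<le> 1 / 2" "binary_entropy r < \<eta> / 2" using small_radius[of "\<eta> / 2"] \<eta> by auto
  have "\<forall>\<^sub>F n in sequentially. \<forall>S \<subseteq> blocks n. card S \<le> 2 powr (n * (binary_entropy p - \<eta> / 2)) \<longrightarrow>
           measure_pmf.prob (replicate_pmf n P) S \<le> 1 / 3"
    by (rule prob_small_set[OF p P]) (use \<eta> in auto)
  then have "\<forall>\<^sub>F n in sequentially. \<forall>A S. A \<subseteq> blocks n \<longrightarrow> S \<subseteq> blocks n \<longrightarrow>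
       (\<forall>x\<in>S. \<exists>y\<in>A. hamming_dist n y x \<le> r) \<longrightarrow> measure_pmf.prob (replicate_pmf n P) S \<ge> 1 / 2 \<longrightarrow>
       card A \<ge> 2 powr (n * (binary_entropy p - \<eta>))"
    using eventually_ge_at_top[of 1]
  proof eventually_elim
    case (elim n)
    show ?case
    proof (intro allI impI, rule ccontr)
      fix A S :: "bit list set"
      assume A: "A \<subseteq> blocks n" and S: "S \<subseteq> blocks n" and cov: "\<forall>x\<in>S. \<exists>y\<in>A. hamming_dist n y x \<le> r"
        and pr: "measure_pmf.prob (replicate_pmf n P) S \<ge> 1 / 2"
        and c: "\<not> card A \<ge> 2 powr (n * (binary_entropy p - \<eta>))"
      have finA: "finite A" using A finite_subset finite_blocks by blast
      let ?B = "\<lambda>y. {x \<in> blocks n. hamming_dist n y x \<le> r}"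
      have "card S \<le> card (\<Union>y\<in>A. ?B y)"
        by (rule card_mono) (use finA cov S in \<open>auto\<close>)
      also have "\<dots> \<le> (\<Sum>y\<in>A. card (?B y))" by (rule card_UN_le[OF finA])
      finally have "real (card S) \<le> (\<Sum>y\<in>A. real (card (?B y)))" by (simp flip: of_nat_sum)
      also have "\<dots> \<le> (\<Sum>y\<in>A. 2 powr (n * binary_entropy r))"
        using A r elim(2) by (intro sum_mono card_hamming_ball) auto
      also have "\<dots> = card A * 2 powr (n * binary_entropy r)" by simp
      also have "\<dots> \<le> 2 powr (n * (binary_entropy p - \<eta>)) * 2 powr (n * binary_entropy r)"
        using c by (intro mult_right_mono) auto
      also have "\<dots> = 2 powr (n * (binary_entropy p - \<eta> + binary_entropy r))"
        by (simp add: powr_add[symmetric] algebra_simps)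
      also have "\<dots> \<le> 2 powr (n * (binary_entropy p - \<eta> / 2))"
        using r by (intro powr_mono mult_left_mono) auto
      finally have "measure_pmf.prob (replicate_pmf n P) S \<le> 1 / 3" using elim(1) S by blast
      with pr show False by simp
    qed
  qed
  then show thesis by (rule that[OF r(1)])
qed

section \<open>Best responses and the converse bounds\<close>

text \<open>The normalized number of observed ones that are recovered as zeros; \<open>missed n x y\<close> is the opposite error.\<close>

definition missed :: "nat \<Rightarrow> bit list \<Rightarrow> bit list \<Rightarrow> real" where
  "missed n y x = real (card {i. i < n \<and> y ! i = 0 \<and> x ! i = 1}) / real n"

lemma card_less_sum: "real (card {i. i < (n::nat) \<and> Q i}) = (\<Sum>i<n. of_bool (Q i))"
proof -
  have "{i. i < n \<and> Q i} = {..<n} \<inter> {i. Q i}" by auto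
  then show ?thesis by (simp add: of_bool_def sum.If_cases)
qed

lemma missed_nonneg: "missed n y x \<ge> 0"
  by (simp add: missed_def)

text \<open>Together with \<open>hamming_dist_missed\<close> and \<open>zero_freq_diff\<close> this
  expresses utility, distance and change of type through the same two one-sided errors, which
  reduces later comparisons to linear arithmetic.\<close>

lemma block_utility_missed:
  assumes "U 0 0 = 0" "U 1 1 = 0"
  shows "block_utility U n y x = U 0 1 * missed n y x + U 1 0 * missed n x y"
proof -
  have "U (y ! i) (x ! i) = U 0 1 * of_bool (y ! i = 0 \<and> x ! i = 1) + U 1 0 * of_bool (x ! i = 0 \<and> y ! i = 1)" for i
    using assms by (cases "y ! i"; cases "x ! i") auto
  then show ?thesis
    unfolding block_utility_def missed_def card_less_sum
    by (simp only: sum.distrib sum_distrib_left add_divide_distrib) (simp add: mult.commute)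
qed

lemma hamming_dist_missed: "hamming_dist n y x = missed n y x + missed n x y"
proof -
  have "of_bool (y ! i \<noteq> x ! i) = of_bool (y ! i = 0 \<and> x ! i = 1) + (of_bool (x ! i = 0 \<and> y ! i = 1) :: real)" for i
    by (cases "y ! i"; cases "x ! i") auto
  then show ?thesis
    unfolding hamming_dist_def missed_def card_less_sum
    by (simp only: sum.distrib add_divide_distrib)
qed

lemma zero_freq_diff: "zero_freq n y - zero_freq n x = missed n y x - missed n x y"
proof -
  have "of_bool (y ! i = 0) - of_bool (x ! i = 0)
     = of_bool (y ! i = 0 \<and> x ! i = 1) - (of_bool (x ! i = 0 \<and> y ! i = 1) :: real)" for i
    by (cases "y ! i"; cases "x ! i") auto
  then show ?thesis
    unfolding zero_freq_def missed_def card_less_sum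
    by (simp only: sum_subtractf[symmetric] diff_divide_distrib[symmetric])
qed

lemma missed_le_zero_freq: "missed n y x \<le> zero_freq n y"
  unfolding missed_def zero_freq_def by (intro divide_right_mono of_nat_mono card_mono) auto

lemma hamming_dist_nonneg: "hamming_dist n y x \<ge> 0"
  by (simp add: hamming_dist_def)

lemma hamming_dist_commute: "hamming_dist n y x = hamming_dist n x y"
  by (simp add: hamming_dist_def eq_commute)

lemma hamming_dist_self: "hamming_dist n x x = 0"
  by (simp add: hamming_dist_def)

lemma hamming_dist_triangle: "hamming_dist n x z \<le> hamming_dist n x y + hamming_dist n y z"
proof -
  have "(\<Sum>i<n. of_bool (x ! i \<noteq> z ! i)) \<le> (\<Sum>i<n. of_bool (x ! i \<noteq> y ! i) + of_bool (y ! i \<noteq> z ! i) :: real)"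
    by (intro sum_mono) auto
  then show ?thesis
    unfolding hamming_dist_def card_less_sum add_divide_distrib[symmetric] sum.distrib
    by (rule divide_right_mono) simp
qed

lemma hamming_dist_eq_0:
  assumes "n \<ge> 1" "x \<in> blocks n" "y \<in> blocks n" "hamming_dist n y x \<le> 0"
  shows "y = x"
proof -
  have "card {k. k < n \<and> y ! k \<noteq> x ! k} = 0"
    using assms by (simp add: hamming_dist_def divide_le_0_iff)
  then have "{k. k < n \<and> y ! k \<noteq> x ! k} = {}" by (subst (asm) card_0_eq) auto
  then show ?thesis using assms by (auto simp: blocks_def intro!: nth_equalityI)
qed

section \<open>Best responses as optimal words of the image, and worst responses\<close>

lemma strategies_image: "g \<in> strategies n \<Longrightarrow> g ` blocks n \<subseteq> blocks n"
  by (auto simp: strategies_def)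

lemma blocks_nonempty: "(blocks n :: 'a::finite list set) \<noteq> {}"
  using Ex_list_of_length[of n] by (auto simp: blocks_def)

text \<open>The sender can reach any word of the image for any block, already by a constant
  strategy, so optimality splits into separate maximizations, one for each observed block.\<close>

lemma best_response_iff:
  fixes g :: "'a::finite list \<Rightarrow> 'a list"
  assumes g: "g \<in> strategies n"
  shows "s \<in> best_responses U n g \<longleftrightarrow> s \<in> strategies n \<and>
    (\<forall>x\<in>blocks n. \<forall>y\<in>g ` blocks n. block_utility U n y x \<le> block_utility U n (g (s x)) x)"
proof (intro iffI conjI ballI)
  fix x y :: "'a list" assume s: "s \<in> best_responses U n g" and x: "x \<in> blocks n" and "y \<in> g ` blocks n"
  then obtain m where m: "m \<in> blocks n" "y = g m" by auto
  have "(\<lambda>x\<in>blocks n. m) \<in> strategies n" using m by (auto simp: strategies_def)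
  then have "block_utility U n (g ((\<lambda>x\<in>blocks n. m) x)) x \<le> block_utility U n (g (s x)) x"
    using s x unfolding best_responses_def by blast
  then show "block_utility U n y x \<le> block_utility U n (g (s x)) x" using x m by simp
next
  assume "s \<in> strategies n \<and>
    (\<forall>x\<in>blocks n. \<forall>y\<in>g ` blocks n. block_utility U n y x \<le> block_utility U n (g (s x)) x)"
  then show "s \<in> best_responses U n g" by (auto simp: best_responses_def strategies_def)
qed (auto simp: best_responses_def)

text \<open>Preimages under \<open>g\<close> can be picked block by block, so every blockwise
  selection of optimal words comes from some best response. This later builds the adversarial sender
  in the case of indifference.\<close>

lemma best_response_choice:
  assumes g: "g \<in> strategies n"
    and f: "\<And>x. x \<in> blocks n \<Longrightarrow> f x \<in> g ` blocks n"
    and opt: "\<And>x y. x \<in> blocks n \<Longrightarrow> y \<in> g ` blocks n \<Longrightarrow> block_utility U n y x \<le> block_utility U n (f x) x"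
  obtains s where "s \<in> best_responses U n g" "\<And>x. x \<in> blocks n \<Longrightarrow> g (s x) = f x"
proof -
  define s where "s = (\<lambda>x\<in>blocks n. SOME m. m \<in> blocks n \<and> g m = f x)"
  have s: "s x \<in> blocks n \<and> g (s x) = f x" if "x \<in> blocks n" for x
  proof -
    have "\<exists>m. m \<in> blocks n \<and> g m = f x" using f[OF that] by force
    then show ?thesis using that someI_ex[of "\<lambda>m. m \<in> blocks n \<and> g m = f x"] unfolding s_def by simp
  qed
  have "s \<in> strategies n" using s unfolding strategies_def by (auto simp: s_def)
  then have "s \<in> best_responses U n g" using s opt by (auto simp: best_response_iff[OF g])
  then show thesis using s that by blast
qed

lemma best_responses_nonempty:
  fixes U :: "'a::finite \<Rightarrow> 'a \<Rightarrow> real"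
  assumes g: "g \<in> strategies n"
  shows "best_responses U n g \<noteq> {}"
proof -
  have "\<exists>y\<in>g ` blocks n. \<forall>y'\<in>g ` blocks n. block_utility U n y' x \<le> block_utility U n y x" for x
  proof -
    have "Max ((\<lambda>y. block_utility U n y x) ` g ` blocks n) \<in> (\<lambda>y. block_utility U n y x) ` g ` blocks n"
      using blocks_nonempty by (intro Max_in) auto
    then obtain y where y: "Max ((\<lambda>y. block_utility U n y x) ` g ` blocks n) = block_utility U n y x"
      "y \<in> g ` blocks n" by (rule imageE)
    have "block_utility U n y' x \<le> block_utility U n y x" if "y' \<in> g ` blocks n" for y'
    proof -
      have "finite ((\<lambda>y. block_utility U n y x) ` g ` blocks n)"
        by (intro finite_imageI finite_blocks)
      then have "block_utility U n y' x \<le> Max ((\<lambda>y. block_utility U n y x) ` g ` blocks n)"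
        using imageI[OF that] by (rule Max_ge)
      also note y(1)
      finally show ?thesis .
    qed
    then show ?thesis using y(2) by blast
  qed
  then have "\<forall>x. \<exists>y. y \<in> g ` blocks n \<and> (\<forall>y'\<in>g ` blocks n. block_utility U n y' x \<le> block_utility U n y x)"
    unfolding Bex_def by (rule allI)
  then obtain f where f: "\<forall>x. f x \<in> g ` blocks n \<and> (\<forall>y'\<in>g ` blocks n. block_utility U n y' x \<le> block_utility U n (f x) x)"
    unfolding choice_iff by (rule exE)
  obtain s where "s \<in> best_responses U n g"
    by (rule best_response_choice[OF g, of f U]) (use f in blast)+
  then show ?thesis by blast
qed

lemma finite_best_responses: "finite (best_responses U n g)"
proof (rule finite_subset)
  show "best_responses U n g \<subseteq> strategies n" by (auto simp: best_responses_def)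
  show "finite (strategies n :: ('a list \<Rightarrow> 'a list) set)"
    unfolding strategies_def by (intro finite_PiE) auto
qed

lemma error_prob_bounds: "0 \<le> error_prob P n d g s" "error_prob P n d g s \<le> 1"
  by (auto simp: error_prob_def)

lemma error_prob_le_worst:
  "s \<in> best_responses U n g \<Longrightarrow> error_prob P n d g s \<le> worst_error U P n d g"
  unfolding worst_error_def using finite_best_responses by (intro Max_ge) auto

lemma worst_error_le_1:
  assumes "g \<in> strategies n" shows "worst_error U P n d g \<le> 1"
  unfolding worst_error_def
  by (subst Max_le_iff) (use finite_best_responses best_responses_nonempty[OF assms] error_prob_bounds in auto)

text \<open>Connects the arg max in the definition of achievability with the maximum
  \<open>worst_error\<close>, which is attained because the best responses form a finite nonempty
  set.\<close>

lemma worst_response_iff: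
  assumes g: "g \<in> strategies n"
  shows "s \<in> worst_responses U P n d g \<longleftrightarrow> s \<in> best_responses U n g \<and> error_prob P n d g s = worst_error U P n d g"
proof
  assume s: "s \<in> worst_responses U P n d g"
  then have b: "s \<in> best_responses U n g" by (simp add: worst_responses_def is_arg_max_def)
  have "worst_error U P n d g \<le> error_prob P n d g s"
    unfolding worst_error_def using s best_responses_nonempty[OF g]
    by (subst Max_le_iff) (auto simp: worst_responses_def is_arg_max_linorder finite_best_responses)
  then show "s \<in> best_responses U n g \<and> error_prob P n d g s = worst_error U P n d g"
    using b error_prob_le_worst[OF b, of P d] by simp
next
  assume "s \<in> best_responses U n g \<and> error_prob P n d g s = worst_error U P n d g"
  then show "s \<in> worst_responses U P n d g"
    using error_prob_le_worst[of _ U n g P d] by (auto simp: worst_responses_def is_arg_max_linorder)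
qed

lemma worst_responses_nonempty:
  assumes g: "g \<in> strategies n"
  shows "worst_responses U P n d g \<noteq> {}"
proof -
  have "worst_error U P n d g \<in> error_prob P n d g ` best_responses U n g"
    unfolding worst_error_def using finite_best_responses best_responses_nonempty[OF g] by (intro Max_in) auto
  then show ?thesis using worst_response_iff[OF g, of _ U P d] by fastforce
qed

section \<open>Rates of recovered images and the lower bound H(p)\<close>

lemma recovered_set_subset: "recovered_set n d g s \<subseteq> blocks n"
  by (auto simp: recovered_set_def)

lemma prob_recovered: "measure_pmf.prob (replicate_pmf n P) (recovered_set n d g s) = 1 - error_prob P n d g s"
  by (simp add: error_prob_def)

lemma recovered_image_subset:
  "g \<in> strategies n \<Longrightarrow> recovered_image n d g s \<subseteq> blocks n"
  using strategies_image by (fastforce simp: recovered_image_def)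

lemma rate_le:
  assumes g: "g \<in> strategies n" and n: "n \<ge> 1" and A: "recovered_image n d g s \<subseteq> A" "finite A"
    and c: "card A \<le> 2 powr (n * h)" and h: "h \<ge> 0"
  shows "rate n d g s \<le> h"
proof (cases "card (recovered_image n d g s) = 0")
  case True
  \<comment> \<open>An empty image has rate 0 by the convention \<open>log 2 0 = 0\<close>; this is
    where \<open>h \<ge> 0\<close> enters.\<close>
  then show ?thesis using h by (simp add: rate_def log_def)
next
  case False
  have "real (card (recovered_image n d g s)) \<le> card A" using A by (simp add: card_mono)
  then have "log 2 (card (recovered_image n d g s)) \<le> n * h"
    using False c by (subst log_le_iff) auto
  then show ?thesis using n by (simp add: rate_def divide_le_eq mult.commute)
qed

lemma rate_le_1:
  fixes g :: "bit list \<Rightarrow> bit list"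
  assumes g: "g \<in> strategies n" and n: "n \<ge> 1"
  shows "rate n d g s \<le> 1"
proof (rule rate_le[OF g n, of d s "blocks n"])
  show "real (card (blocks n :: bit list set)) \<le> 2 powr (real n * 1)"
    by (simp add: card_blocks_bit powr_realpow)
qed (use recovered_image_subset[OF g] in auto)

text \<open>The recovered image covers the recovered set with radius d, so
  \<open>covering_card\<close> bounds its size from below. Both r and the threshold for n are fixed
  before g, s and d, so the bound applies along sequences with varying \<delta> n.\<close>

lemma rate_lower_bound:
  fixes P :: "bit pmf"
  assumes p: "0 < p" "p < 1" and P: "pmf P 0 = p" and \<eta>: "\<eta> > 0"
  obtains r where "r > 0"
    "\<forall>\<^sub>F n in sequentially. \<forall>g\<in>strategies n. \<forall>s d. s \<in> strategies n \<longrightarrow> d \<le> r \<longrightarrow>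
       error_prob P n d g s \<le> 1 / 2 \<longrightarrow> rate n d g s \<ge> binary_entropy p - \<eta>"
proof -
  obtain r where r: "r > 0" and ev: "\<forall>\<^sub>F n in sequentially. \<forall>A S. A \<subseteq> blocks n \<longrightarrow> S \<subseteq> blocks n \<longrightarrow>
       (\<forall>x\<in>S. \<exists>y\<in>A. hamming_dist n y x \<le> r) \<longrightarrow> measure_pmf.prob (replicate_pmf n P) S \<ge> 1 / 2 \<longrightarrow>
       card A \<ge> 2 powr (n * (binary_entropy p - \<eta>))"
    using covering_card[OF p P \<eta>] by blast
  have "\<forall>\<^sub>F n in sequentially. \<forall>g\<in>strategies n. \<forall>s d. s \<in> strategies n \<longrightarrow> d \<le> r \<longrightarrow>
       error_prob P n d g s \<le> 1 / 2 \<longrightarrow> rate n d g s \<ge> binary_entropy p - \<eta>"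
    using ev eventually_ge_at_top[of 1]
  proof eventually_elim
    case (elim n)
    show ?case
    proof (intro ballI allI impI)
      fix g s :: "bit list \<Rightarrow> bit list" and d
      assume g: "g \<in> strategies n" and s: "s \<in> strategies n" and d: "d \<le> r" and e: "error_prob P n d g s \<le> 1 / 2"
      let ?A = "recovered_image n d g s"
      have sb: "s x \<in> blocks n" if "x \<in> blocks n" for x using s that by (auto simp: strategies_def)
      have cov: "\<forall>x\<in>recovered_set n d g s. \<exists>y\<in>?A. hamming_dist n y x \<le> r"
      proof
        fix x assume x: "x \<in> recovered_set n d g s"
        then have "g (s x) \<in> ?A" using sb by (auto simp: recovered_image_def recovered_set_def)
        moreover have "hamming_dist n (g (s x)) x \<le> r" using x d by (auto simp: recovered_set_def)
        ultimately show "\<exists>y\<in>?A. hamming_dist n y x \<le> r" by blast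
      qed
      have pr: "measure_pmf.prob (replicate_pmf n P) (recovered_set n d g s) \<ge> 1 / 2"
        using e by (simp add: prob_recovered)
      have c: "card ?A \<ge> 2 powr (n * (binary_entropy p - \<eta>))"
        by (rule elim(1)[rule_format, OF recovered_image_subset[OF g] recovered_set_subset _ pr])
          (rule bspec[OF cov])
      then have pos: "real (card ?A) > 0" by (rule less_le_trans[rotated]) simp
      have "log 2 (card ?A) \<ge> n * (binary_entropy p - \<eta>)"
        using c pos by (subst le_log_iff) auto
      then show "rate n d g s \<ge> binary_entropy p - \<eta>"
        using elim(2) by (simp add: rate_def le_divide_eq mult.commute)
    qed
  qed
  then show thesis by (rule that[OF r])
qed

lemma achievableE:
  fixes P :: "'a::finite pmf"
  assumes "achievable U P 0 R"
  obtains g s :: "nat \<Rightarrow> 'a list \<Rightarrow> 'a list" and \<delta> \<epsilon> :: "nat \<Rightarrow> real"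
  where "\<forall>n\<ge>1. g n \<in> strategies n" "\<forall>n\<ge>1. s n \<in> best_responses U n (g n)"
    "\<forall>n\<ge>1. error_prob P n (\<delta> n) (g n) (s n) = worst_error U P n (\<delta> n) (g n)"
    "\<forall>n\<ge>1. error_prob P n (\<delta> n) (g n) (s n) < \<epsilon> n"
    "\<epsilon> \<longlonglongrightarrow> 0" "\<delta> \<longlonglongrightarrow> 0" "(\<lambda>n. rate n (\<delta> n) (g n) (s n)) \<longlonglongrightarrow> R"
proof -
  obtain g s :: "nat \<Rightarrow> 'a list \<Rightarrow> 'a list" and \<epsilon> \<delta> :: "nat \<Rightarrow> real"
    where gs: "\<forall>n\<ge>1. g n \<in> strategies n \<and> s n \<in> worst_responses U P n (\<delta> n) (g n) \<and>
        error_prob P n (\<delta> n) (g n) (s n) < \<epsilon> n"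
      and lims: "\<epsilon> \<longlonglongrightarrow> 0" "\<delta> \<longlonglongrightarrow> 0" "(\<lambda>n. rate n (\<delta> n) (g n) (s n)) \<longlonglongrightarrow> R"
    using assms unfolding achievable_def add_0_left by blast
  show thesis
    by (rule that[of g s \<delta> \<epsilon>]) (use gs lims worst_response_iff in \<open>blast+\<close>)
qed

lemma strategies_of_best: "s \<in> best_responses U n g \<Longrightarrow> s \<in> strategies n"
  by (simp add: best_responses_def)

lemma achievable_lower:
  fixes P :: "bit pmf"
  assumes p: "0 < p" "p < 1" and P: "pmf P 0 = p" and R: "achievable U P 0 R"
  shows "binary_entropy p \<le> R"
proof (rule field_le_epsilon)
  fix \<eta> :: real assume \<eta>: "\<eta> > 0"
  obtain g s \<delta> \<epsilon> where "\<forall>n\<ge>1. g n \<in> strategies n" "\<forall>n\<ge>1. s n \<in> best_responses U n (g n)"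
      "\<forall>n\<ge>1. error_prob P n (\<delta> n) (g n) (s n) = worst_error U P n (\<delta> n) (g n)"
      "\<forall>n\<ge>1. error_prob P n (\<delta> n) (g n) (s n) < \<epsilon> n"
    and lims: "\<epsilon> \<longlonglongrightarrow> 0" "\<delta> \<longlonglongrightarrow> 0" and lim: "(\<lambda>n. rate n (\<delta> n) (g n) (s n)) \<longlonglongrightarrow> R"
    by (rule achievableE[OF R])
  note g = this(1)[rule_format] and s = this(2)[rule_format] and err = this(4)[rule_format]
  obtain r where r: "r > 0" and ev:
    "\<forall>\<^sub>F n in sequentially. \<forall>g\<in>strategies n. \<forall>s d. s \<in> strategies n \<longrightarrow> d \<le> r \<longrightarrow>
       error_prob P n d g s \<le> 1 / 2 \<longrightarrow> rate n d g s \<ge> binary_entropy p - \<eta>"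
    using rate_lower_bound[OF p P \<eta>] by blast
  have "\<forall>\<^sub>F n in sequentially. \<epsilon> n < 1 / 2" using lims(1) by (rule order_tendstoD) simp
  moreover have "\<forall>\<^sub>F n in sequentially. \<delta> n < r" using lims(2) r by (rule order_tendstoD)
  ultimately have "\<forall>\<^sub>F n in sequentially. binary_entropy p - \<eta> \<le> rate n (\<delta> n) (g n) (s n)"
    using ev eventually_ge_at_top[of 1]
  proof eventually_elim
    case (elim n)
    have "s n \<in> strategies n"
      using strategies_of_best[OF s[OF elim(4)]] .
    then show ?case using elim g[OF elim(4)] err[OF elim(4)] by fastforce
  qed
  then have "binary_entropy p - \<eta> \<le> R" by (rule tendsto_lowerbound[OF lim]) simp
  then show "binary_entropy p \<le> R + \<eta>" by simp
qed

lemma achievable_le_1: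
  fixes P :: "bit pmf"
  assumes R: "achievable U P 0 R"
  shows "R \<le> 1"
proof -
  obtain g s \<delta> \<epsilon> where "\<forall>n\<ge>1. g n \<in> strategies n" "\<forall>n\<ge>1. s n \<in> best_responses U n (g n)"
      "\<forall>n\<ge>1. error_prob P n (\<delta> n) (g n) (s n) = worst_error U P n (\<delta> n) (g n)"
      "\<forall>n\<ge>1. error_prob P n (\<delta> n) (g n) (s n) < \<epsilon> n"
    and lims: "\<epsilon> \<longlonglongrightarrow> 0" "\<delta> \<longlonglongrightarrow> 0" and lim: "(\<lambda>n. rate n (\<delta> n) (g n) (s n)) \<longlonglongrightarrow> R"
    by (rule achievableE[OF R])
  note g = this(1)[rule_format]
  have "\<forall>\<^sub>F n in sequentially. rate n (\<delta> n) (g n) (s n) \<le> 1"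
    using eventually_ge_at_top[of 1] by eventually_elim (use g rate_le_1 in blast)
  then show ?thesis by (rule tendsto_upperbound[OF lim]) simp
qed

section \<open>Nonnegative sum of utilities: recovered blocks cluster\<close>

text \<open>For a positive sum every best response works: adding the optimality conditions at x and
  x', and accounting for the distance of the recovered words from x and x', gives distance at most 2
  d. For sum zero all blocks share the same optimal words. Two of these more than 2 d apart let the
  sender prevent recovery altogether; otherwise the triangle inequality gives d + 2 d + d, the
  source of the constant 4.\<close>

lemma clustered_response:
  fixes U :: "bit \<Rightarrow> bit \<Rightarrow> real"
  assumes U: "U 0 0 = 0" "U 1 1 = 0" and sum: "U 0 1 + U 1 0 \<ge> 0" and d: "d \<ge> 0"
    and n: "n \<ge> 1" and g: "g \<in> strategies n"
  obtains s where "s \<in> best_responses U n g"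
    "\<And>x x'. x \<in> recovered_set n d g s \<Longrightarrow> x' \<in> recovered_set n d g s \<Longrightarrow> hamming_dist n x x' \<le> 4 * d"
proof (cases "U 0 1 + U 1 0 > 0")
  case True
  obtain s where s: "s \<in> best_responses U n g" using best_responses_nonempty[OF g] by blast
  show thesis
  proof (rule that[OF s])
    fix x x' assume x: "x \<in> recovered_set n d g s" and x': "x' \<in> recovered_set n d g s"
    define y y' where "y = g (s x)" and "y' = g (s x')"
    define \<gamma> where "\<gamma> = U 0 1 + U 1 0"
    have b: "x \<in> blocks n" "x' \<in> blocks n" "hamming_dist n y x \<le> d" "hamming_dist n y' x' \<le> d"
      using x x' by (auto simp: recovered_set_def y_def y'_def)
    have im: "y \<in> g ` blocks n" "y' \<in> g ` blocks n"
      using b s strategies_of_best unfolding y_def y'_def strategies_def by (fast+)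
    have opt: "block_utility U n y' x \<le> block_utility U n y x" "block_utility U n y x' \<le> block_utility U n y' x'"
      using s b im by (auto simp: best_response_iff[OF g] y_def y'_def)
    \<comment> \<open>Where y, y' agree with x, x', equality holds: the swapped utilities add up to
      \<gamma> if x and x' differ there and to 0 otherwise. Each disagreement is paid for by one
      further \<gamma>.\<close>
    have idx: "\<gamma> * of_bool (x ! i \<noteq> x' ! i) + U (y ! i) (x ! i) + U (y' ! i) (x' ! i)
       \<le> U (y' ! i) (x ! i) + U (y ! i) (x' ! i) + \<gamma> * of_bool (y ! i \<noteq> x ! i) + \<gamma> * of_bool (y' ! i \<noteq> x' ! i)" for i
      using U sum by (cases "x ! i"; cases "x' ! i"; cases "y ! i"; cases "y' ! i") (auto simp: \<gamma>_def)
    have "(\<Sum>i<n. \<gamma> * of_bool (x ! i \<noteq> x' ! i) + U (y ! i) (x ! i) + U (y' ! i) (x' ! i))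
       \<le> (\<Sum>i<n. U (y' ! i) (x ! i) + U (y ! i) (x' ! i) + \<gamma> * of_bool (y ! i \<noteq> x ! i) + \<gamma> * of_bool (y' ! i \<noteq> x' ! i))"
      by (intro sum_mono idx)
    then have "(\<Sum>i<n. \<gamma> * of_bool (x ! i \<noteq> x' ! i) + U (y ! i) (x ! i) + U (y' ! i) (x' ! i)) / n
       \<le> (\<Sum>i<n. U (y' ! i) (x ! i) + U (y ! i) (x' ! i) + \<gamma> * of_bool (y ! i \<noteq> x ! i) + \<gamma> * of_bool (y' ! i \<noteq> x' ! i)) / n"
      by (rule divide_right_mono) simp
    then have "\<gamma> * hamming_dist n x x' + block_utility U n y x + block_utility U n y' x'
       \<le> block_utility U n y' x + block_utility U n y x' + \<gamma> * hamming_dist n y x + \<gamma> * hamming_dist n y' x'"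
      unfolding sum.distrib add_divide_distrib hamming_dist_def block_utility_def card_less_sum sum_distrib_left[symmetric]
      by (simp only: times_divide_eq_right)
    then have "\<gamma> * hamming_dist n x x' \<le> \<gamma> * (hamming_dist n y x + hamming_dist n y' x')"
      using opt by (simp add: distrib_left)
    then have "hamming_dist n x x' \<le> hamming_dist n y x + hamming_dist n y' x'"
      using True by (simp add: \<gamma>_def)
    then show "hamming_dist n x x' \<le> 4 * d" using b d by linarith
  qed
next
  case False
  then have U10: "U 1 0 = - U 0 1" using sum by simp
  have util: "block_utility U n y x = U 0 1 * zero_freq n y - U 0 1 * zero_freq n x" for y x
  proof -
    have "block_utility U n y x = U 0 1 * (missed n y x - missed n x y)"
      by (simp add: block_utility_missed[of U, OF U] U10 algebra_simps)
    then show ?thesis unfolding zero_freq_diff[symmetric] by (simp add: algebra_simps)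
  qed
  \<comment> \<open>The set of optimal words does not depend on the observed block.\<close>
  define Opt where "Opt = {y \<in> g ` blocks n. \<forall>y'\<in>g ` blocks n. U 0 1 * zero_freq n y' \<le> U 0 1 * zero_freq n y}"
  show thesis
  proof (cases "\<exists>y1\<in>Opt. \<exists>y2\<in>Opt. hamming_dist n y1 y2 > 2 * d")
    case True
    then obtain y1 y2 where y: "y1 \<in> Opt" "y2 \<in> Opt" "hamming_dist n y1 y2 > 2 * d" by blast
    \<comment> \<open>No \<open>x\<close> is within \<open>d\<close> of both \<open>y1\<close> and \<open>y2\<close>, so an indifferent sender can spoil every block.\<close>
    define f where "f x = (if hamming_dist n y1 x > d then y1 else y2)" for x
    have f: "f x \<in> Opt" for x using y by (simp add: f_def)
    obtain s where s: "s \<in> best_responses U n g" "\<And>x. x \<in> blocks n \<Longrightarrow> g (s x) = f x"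
      by (rule best_response_choice[OF g, of f U]) (use f in \<open>auto simp: Opt_def util\<close>)
    have "hamming_dist n (f x) x > d" for x
      using y(3) hamming_dist_triangle[of n y1 y2 x] hamming_dist_commute[of n y2 x] by (auto simp: f_def)
    then have "\<not> hamming_dist n (g (s x)) x \<le> d" if "x \<in> blocks n" for x
      using s(2)[OF that] by (simp add: not_le)
    then have "recovered_set n d g s = {}" by (auto simp: recovered_set_def)
    then show thesis using that[OF s(1)] by simp
  next
    case False
    obtain s where s: "s \<in> best_responses U n g" using best_responses_nonempty[OF g] by blast
    have opt: "g (s x) \<in> Opt" if "x \<in> blocks n" for x
    proof -
      have "s x \<in> blocks n" using strategies_of_best[OF s] that by (auto simp: strategies_def)
      then show ?thesis using s that by (auto simp: Opt_def best_response_iff[OF g] util)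
    qed
    show thesis
    proof (rule that[OF s])
      fix x x' assume x: "x \<in> recovered_set n d g s" and x': "x' \<in> recovered_set n d g s"
      have "hamming_dist n (g (s x)) (g (s x')) \<le> 2 * d"
        using False opt x x' by (force simp: recovered_set_def not_less)
      moreover have "hamming_dist n (g (s x)) x \<le> d" "hamming_dist n (g (s x')) x' \<le> d"
        using x x' by (auto simp: recovered_set_def)
      ultimately show "hamming_dist n x x' \<le> 4 * d"
        using hamming_dist_triangle[of n x x' "g (s x)"] hamming_dist_triangle[of n "g (s x)" x' "g (s x')"]
          hamming_dist_commute[of n x "g (s x)"] by linarith
    qed
  qed
qed

lemma error_prob_antimono: "d \<le> d' \<Longrightarrow> error_prob P n d' g s \<le> error_prob P n d g s"
  unfolding error_prob_def
  by (intro diff_left_mono measure_pmf.finite_measure_mono) (auto simp: recovered_set_def)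

text \<open>For the response from \<open>clustered_response\<close> at level r/4, the recovered set
  lies in a ball of radius 4 (r/4) = r around any of its points. As H(r) < H(p)/2, such a ball has
  vanishing probability. Lowering the level only raises the error, so the same response serves all
  d' \<le> r/4.\<close>

lemma worst_error_near_1:
  fixes U :: "bit \<Rightarrow> bit \<Rightarrow> real" and P :: "bit pmf"
  assumes p: "0 < p" "p < 1" and P: "pmf P 0 = p"
    and U: "U 0 0 = 0" "U 1 1 = 0" and sum: "U 0 1 + U 1 0 \<ge> 0"
  obtains d where "d > 0"
    "\<And>e. e > 0 \<Longrightarrow> \<forall>\<^sub>F n in sequentially. \<forall>g\<in>strategies n. \<forall>d'\<le>d. worst_error U P n d' g \<ge> 1 - e"
proof -
  have H: "binary_entropy p > 0" by (rule binary_entropy_pos[OF p])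
  obtain r where r: "0 < r" "r \<le> 1 / 2" "binary_entropy r < binary_entropy p / 2"
    using small_radius[of "binary_entropy p / 2"] H by auto
  show thesis
  proof (rule that[of "r / 4"])
    fix e :: real assume e: "e > 0"
    have "\<forall>\<^sub>F n in sequentially. \<forall>S \<subseteq> blocks n. card S \<le> 2 powr (n * (binary_entropy p - binary_entropy p / 2)) \<longrightarrow>
           measure_pmf.prob (replicate_pmf n P) S \<le> e"
      by (rule prob_small_set[OF p P]) (use H e in auto)
    then show "\<forall>\<^sub>F n in sequentially. \<forall>g\<in>strategies n. \<forall>d'\<le>r / 4. worst_error U P n d' g \<ge> 1 - e"
      using eventually_ge_at_top[of 1]
    proof eventually_elim
      case (elim n)
      show ?case
      proof (intro ballI allI impI)
        fix g :: "bit list \<Rightarrow> bit list" and d' assume g: "g \<in> strategies n" and d': "d' \<le> r / 4"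
        obtain s where s: "s \<in> best_responses U n g" and near: "\<And>x x'. x \<in> recovered_set n (r / 4) g s \<Longrightarrow>
            x' \<in> recovered_set n (r / 4) g s \<Longrightarrow> hamming_dist n x x' \<le> 4 * (r / 4)"
          using clustered_response[OF U sum _ elim(2) g, of "r / 4"] r by auto
        let ?S = "recovered_set n (r / 4) g s"
        have "card ?S \<le> 2 powr (n * (binary_entropy p - binary_entropy p / 2))"
        proof (cases "?S = {}")
          case False
          then obtain x where x: "x \<in> ?S" by blast
          have "?S \<subseteq> {x' \<in> blocks n. hamming_dist n x x' \<le> r}"
            using near[OF x] recovered_set_subset[of n "r / 4" g s] by auto
          then have "card ?S \<le> card {x' \<in> blocks n. hamming_dist n x x' \<le> r}"
            by (intro card_mono finite_subset[OF _ finite_blocks]) auto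
          also have "real \<dots> \<le> 2 powr (n * binary_entropy r)"
            using x recovered_set_subset[of n "r / 4" g s] r elim(2) by (intro card_hamming_ball) auto
          also have "\<dots> \<le> 2 powr (n * (binary_entropy p - binary_entropy p / 2))"
            using r by (intro powr_mono mult_left_mono) auto
          finally show ?thesis by simp
        qed simp
        then have "measure_pmf.prob (replicate_pmf n P) ?S \<le> e"
          using elim(1) recovered_set_subset by blast
        then have "1 - e \<le> error_prob P n (r / 4) g s" by (simp add: error_prob_def)
        also have "\<dots> \<le> error_prob P n d' g s" by (rule error_prob_antimono[OF d'])
        also have "\<dots> \<le> worst_error U P n d' g" by (rule error_prob_le_worst[OF s])
        finally show "worst_error U P n d' g \<ge> 1 - e" .
      qed
    qed
  qed (use r in auto)
qed

lemma worst_error_tendsto_1: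
  assumes g: "\<And>n. n \<ge> 1 \<Longrightarrow> g n \<in> strategies n"
    and low: "\<And>e. e > 0 \<Longrightarrow> \<forall>\<^sub>F n in sequentially. worst_error U P n d (g n) \<ge> 1 - e"
  shows "(\<lambda>n. worst_error U P n d (g n)) \<longlonglongrightarrow> 1"
proof (rule order_tendstoI)
  fix c :: real assume "c < 1"
  then have "\<forall>\<^sub>F n in sequentially. worst_error U P n d (g n) \<ge> 1 - (1 - c) / 2" by (intro low) simp
  then show "\<forall>\<^sub>F n in sequentially. worst_error U P n d (g n) > c"
    by eventually_elim (use \<open>c < 1\<close> in argo)
next
  fix c :: real assume c: "1 < c"
  show "\<forall>\<^sub>F n in sequentially. worst_error U P n d (g n) < c"
    using eventually_ge_at_top[of 1]
    by eventually_elim (use c g worst_error_le_1 in \<open>fastforce intro: le_less_trans\<close>)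
qed

text \<open>Once \<delta> n is below the threshold d, the worst error is at least 1/2, while
  achievability forces it below \<epsilon> n < 1/2. The uniformity of
  \<open>worst_error_near_1\<close> in d' and g admits the varying \<delta> n and g n.\<close>

lemma achievable_imp_sum_neg:
  fixes U :: "bit \<Rightarrow> bit \<Rightarrow> real" and P :: "bit pmf"
  assumes p: "0 < p" "p < 1" and P: "pmf P 0 = p"
    and U: "U 0 0 = 0" "U 1 1 = 0" and R: "achievable U P 0 R"
  shows "U 0 1 + U 1 0 < 0"
proof (rule ccontr)
  assume "\<not> U 0 1 + U 1 0 < 0"
  then have sum: "U 0 1 + U 1 0 \<ge> 0" by simp
  obtain d where d: "d > 0" and low:
    "\<And>e. e > 0 \<Longrightarrow> \<forall>\<^sub>F n in sequentially. \<forall>g\<in>strategies n. \<forall>d'\<le>d. worst_error U P n d' g \<ge> 1 - e"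
    using worst_error_near_1[OF p P U sum] by blast
  obtain g s \<delta> \<epsilon> where "\<forall>n\<ge>1. g n \<in> strategies n" "\<forall>n\<ge>1. s n \<in> best_responses U n (g n)"
      "\<forall>n\<ge>1. error_prob P n (\<delta> n) (g n) (s n) = worst_error U P n (\<delta> n) (g n)"
      "\<forall>n\<ge>1. error_prob P n (\<delta> n) (g n) (s n) < \<epsilon> n"
    and lims: "\<epsilon> \<longlonglongrightarrow> 0" "\<delta> \<longlonglongrightarrow> 0" and lim: "(\<lambda>n. rate n (\<delta> n) (g n) (s n)) \<longlonglongrightarrow> R"
    by (rule achievableE[OF R])
  note g = this(1)[rule_format] and worst = this(3)[rule_format] and err = this(4)[rule_format]
  have "\<forall>\<^sub>F n in sequentially. \<epsilon> n < 1 / 2" using lims(1) by (rule order_tendstoD) simp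
  moreover have "\<forall>\<^sub>F n in sequentially. \<delta> n < d" using lims(2) d by (rule order_tendstoD)
  moreover have "\<forall>\<^sub>F n in sequentially. \<forall>g\<in>strategies n. \<forall>d'\<le>d. worst_error U P n d' g \<ge> 1 - 1 / 2"
    by (rule low) simp
  ultimately have "\<forall>\<^sub>F n::nat in sequentially. False"
    using eventually_ge_at_top[of 1]
  proof eventually_elim
    case (elim n)
    have "worst_error U P n (\<delta> n) (g n) \<ge> 1 - 1 / 2"
      using elim g[OF elim(4)] by (meson less_imp_le)
    then show False using worst[OF elim(4)] err[OF elim(4)] elim(1) by linarith
  qed
  then show False by simp
qed

section \<open>Achievability\<close>

lemma eventually_concentrated:
  fixes P :: "bit pmf"
  assumes P: "pmf P 0 = p" and t: "t > 0" and e: "e > 0"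
  shows "\<forall>\<^sub>F n in sequentially.
    measure_pmf.prob (replicate_pmf n P) {x \<in> blocks n. \<bar>zero_freq n x - p\<bar> \<ge> t} \<le> e"
proof -
  have lim: "(\<lambda>n::nat. 2 * exp (- (real n * c))) \<longlonglongrightarrow> 0" if "c > 0" for c :: real
    using that by real_asymp
  have "(\<lambda>n::nat. 2 * exp (- (real n * (2 * t\<^sup>2)))) \<longlonglongrightarrow> 0" using t by (intro lim) simp
  then have "\<forall>\<^sub>F n::nat in sequentially. 2 * exp (- (real n * (2 * t\<^sup>2))) < e"
    using e by (rule order_tendstoD)
  then show ?thesis using eventually_ge_at_top[of 1]
  proof eventually_elim
    case (elim n)
    have "measure_pmf.prob (replicate_pmf n P) {x \<in> blocks n. \<bar>zero_freq n x - p\<bar> \<ge> t} \<le> 2 * exp (- 2 * real n * t\<^sup>2)"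
      using zero_freq_concentration[OF P elim(2)] t by simp
    then show ?case using elim(1) by (simp add: mult_ac)
  qed
qed

section \<open>The typical type class: nearest words and size\<close>

definition typical_zeros :: "real \<Rightarrow> nat \<Rightarrow> nat" where
  "typical_zeros p n = nat \<lfloor>p * real n\<rfloor>"

text \<open>A single type class rather than all roughly typical words: with the number of zeros
  fixed, utility and distance to a given block become affine functions of the same one-sided
  error.\<close>

definition typical_class :: "real \<Rightarrow> nat \<Rightarrow> bit list set" where
  "typical_class p n = {y \<in> blocks n. card {i. i < n \<and> y ! i = 0} = typical_zeros p n}"

lemma typical_class_subset: "typical_class p n \<subseteq> blocks n"
  by (auto simp: typical_class_def)

lemma zero_freq_typical:
  assumes "y \<in> typical_class p n" shows "zero_freq n y = typical_zeros p n / n"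
  using assms by (simp add: typical_class_def zero_freq_def)

lemma typical_zeros_near:
  assumes p: "0 \<le> p" and n: "n \<ge> 1"
  shows "\<bar>real (typical_zeros p n) / n - p\<bar> \<le> 1 / n"
proof -
  have "p * real n \<ge> 0" using p by simp
  then have "real (typical_zeros p n) = of_int \<lfloor>p * real n\<rfloor>" by (simp add: typical_zeros_def)
  then have "\<bar>real (typical_zeros p n) - p * n\<bar> \<le> 1" by linarith
  moreover have "real (typical_zeros p n) / n - p = (real (typical_zeros p n) - p * n) / n"
    using n by (simp add: field_simps)
  ultimately show ?thesis by (simp add: divide_right_mono)
qed

lemma typical_zeros_le:
  assumes "0 \<le> p" "p \<le> 1" shows "typical_zeros p n \<le> n"
proof -
  have "p * real n \<le> real n" using assms by (simp add: mult_left_le_one_le)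
  then show ?thesis unfolding typical_zeros_def by linarith
qed

text \<open>Choose the zero set W nested with the zero set of x. The changed positions then form the
  difference of the two sets, and their number is the difference of the cardinalities.\<close>

lemma nearest_of_type:
  assumes k: "k \<le> n" and x: "x \<in> blocks n"
  obtains y where "y \<in> blocks n" "card {i. i < n \<and> y ! i = 0} = k"
    "hamming_dist n y x = \<bar>real k / n - zero_freq n x\<bar>"
proof -
  define Z where "Z = {i. i < n \<and> x ! i = 0}"
  have Z: "Z \<subseteq> {..<n}" "finite Z" by (auto simp: Z_def)
  have zx: "zero_freq n x = card Z / n" by (simp add: zero_freq_def Z_def)
  obtain W where W: "W \<subseteq> {..<n}" "card W = k" "W \<subseteq> Z \<or> Z \<subseteq> W"
  proof (cases "k \<le> card Z")
    case True
    then obtain W where "W \<subseteq> Z" "card W = k" using obtain_subset_with_card_n by metis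
    then show thesis using that Z by blast
  next
    case False
    then obtain W where "Z \<subseteq> W" "W \<subseteq> {..<n}" "card W = k"
      using exists_subset_between[of Z k "{..<n}"] Z k by auto
    then show thesis using that by blast
  qed
  have finW: "finite W" using W(1) finite_subset by blast
  define y where "y = map (\<lambda>i. if i \<in> W then 0 else 1 :: bit) [0..<n]"
  have y: "y \<in> blocks n" by (simp add: y_def blocks_def)
  have yi: "y ! i = 0 \<longleftrightarrow> i \<in> W" if "i < n" for i using that by (simp add: y_def)
  have "{i. i < n \<and> y ! i = 0} = W" using W(1) yi by auto
  then have card_y: "card {i. i < n \<and> y ! i = 0} = k" using W by simp
  have "{i. i < n \<and> y ! i \<noteq> x ! i} = (W - Z) \<union> (Z - W)"
  proof -
    have "y ! i \<noteq> x ! i \<longleftrightarrow> \<not> (i \<in> W \<longleftrightarrow> i \<in> Z)" if "i < n" for i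
      using yi[OF that] that by (cases "y ! i"; cases "x ! i") (auto simp: Z_def)
    then show ?thesis using W(1) Z(1) by auto
  qed
  moreover have "real (card ((W - Z) \<union> (Z - W))) = \<bar>real k - card Z\<bar>"
    using W(3)
  proof
    assume s: "W \<subseteq> Z"
    then have "(W - Z) \<union> (Z - W) = Z - W" by auto
    then show ?thesis using s W(2) Z(2) card_mono[OF Z(2) s] by (simp add: card_Diff_subset[OF finW s] of_nat_diff)
  next
    assume s: "Z \<subseteq> W"
    then have "(W - Z) \<union> (Z - W) = W - Z" by auto
    then show ?thesis using s W(2) card_mono[OF finW s] by (simp add: card_Diff_subset[OF Z(2) s] of_nat_diff)
  qed
  ultimately have "hamming_dist n y x = \<bar>real k - card Z\<bar> / n" by (simp add: hamming_dist_def)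
  then have "hamming_dist n y x = \<bar>real k / n - zero_freq n x\<bar>"
    unfolding zx diff_divide_distrib[symmetric] by simp
  then show thesis using that y card_y by blast
qed

lemma typical_neighbour:
  assumes p: "0 \<le> p" "p \<le> 1" and n: "n \<ge> 1" and x: "x \<in> blocks n"
  obtains y where "y \<in> typical_class p n" "hamming_dist n y x \<le> \<bar>zero_freq n x - p\<bar> + 1 / n"
proof -
  obtain y where y: "y \<in> blocks n" "card {i. i < n \<and> y ! i = 0} = typical_zeros p n"
    "hamming_dist n y x = \<bar>real (typical_zeros p n) / n - zero_freq n x\<bar>"
    using nearest_of_type[OF typical_zeros_le[OF p] x] by blast
  have "hamming_dist n y x \<le> \<bar>zero_freq n x - p\<bar> + 1 / n"
    using y(3) typical_zeros_near[OF p(1) n] by linarith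
  moreover have "y \<in> typical_class p n" using y by (simp add: typical_class_def)
  ultimately show thesis using that by blast
qed

lemma typical_class_nonempty:
  assumes p: "0 \<le> p" "p \<le> 1" and n: "n \<ge> 1"
  shows "typical_class p n \<noteq> {}"
proof -
  obtain x :: "bit list" where "x \<in> blocks n" using blocks_nonempty by blast
  then show ?thesis using typical_neighbour[OF p n] by blast
qed

text \<open>Both bounds are probabilistic. The words of the class have equal probability, about
  2^(-n H(p)), with sum at most 1, which bounds their number from above. The class also comes within
  r of every typical block, so \<open>covering_card\<close> bounds it from below.\<close>

lemma typical_class_rate:
  assumes p: "0 < p" "p < 1"
  shows "(\<lambda>n. log 2 (card (typical_class p n)) / n) \<longlonglongrightarrow> binary_entropy p"
proof -
  define P :: "bit pmf" where "P = map_pmf (\<lambda>b. if b then 0 else 1) (bernoulli_pmf p)"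
  have "(\<lambda>b. if b then 0 else (1::bit)) -` {0} = {True}" by (auto split: if_splits)
  then have P: "pmf P 0 = p" using p by (simp add: P_def pmf_map measure_pmf_single)
  define L where "L = log 2 p - log 2 (1 - p)"
  have pos: "card (typical_class p n) > 0" if "n \<ge> 1" for n
    using typical_class_nonempty[of p n] p that finite_subset[OF typical_class_subset finite_blocks]
    by (simp add: card_gt_0_iff)
  \<comment> \<open>The term \<bar>L\<bar>/n accounts for rounding p n to an integer, which moves
    the type by at most 1/n.\<close>
  have up: "log 2 (card (typical_class p n)) / n \<le> binary_entropy p + \<bar>L\<bar> * (1 / n)" if n: "n \<ge> 1" for n
  proof -
    define h where "h = n * ((typical_zeros p n / n - p) * L - binary_entropy p)"
    have "card (typical_class p n) * 2 powr h = (\<Sum>x\<in>typical_class p n. pmf (replicate_pmf n P) x)"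
    proof -
      have "pmf (replicate_pmf n P) x = 2 powr h" if "x \<in> typical_class p n" for x
        using pmf_block[OF p P n subsetD[OF typical_class_subset that]]
        by (simp add: zero_freq_typical[OF that] h_def L_def)
      then show ?thesis by simp
    qed
    also have "\<dots> = measure_pmf.prob (replicate_pmf n P) (typical_class p n)"
      using finite_subset[OF typical_class_subset finite_blocks] by (simp add: measure_measure_pmf_finite)
    also have "\<dots> \<le> 1" by simp
    finally have "card (typical_class p n) \<le> 2 powr (- h)" by (simp add: powr_minus field_simps)
    then have "log 2 (card (typical_class p n)) \<le> - h" using pos[OF n] by (subst log_le_iff) auto
    also have "- h = n * (binary_entropy p - (typical_zeros p n / n - p) * L)"
      by (simp add: h_def algebra_simps)
    also have "\<dots> \<le> n * (binary_entropy p + \<bar>L\<bar> * (1 / n))"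
    proof -
      have "- ((typical_zeros p n / n - p) * L) \<le> \<bar>typical_zeros p n / n - p\<bar> * \<bar>L\<bar>"
        by (metis abs_ge_minus_self abs_mult)
      also have "\<dots> \<le> 1 / n * \<bar>L\<bar>"
        using typical_zeros_near[of p n] p n by (intro mult_right_mono) auto
      finally show ?thesis by (intro mult_left_mono) auto
    qed
    finally show ?thesis using n by (simp add: divide_le_eq mult.commute)
  qed
  show ?thesis
  proof (rule order_tendstoI)
    fix c assume c: "c > binary_entropy p"
    have "(\<lambda>n::nat. binary_entropy p + \<bar>L\<bar> * (1 / n)) \<longlonglongrightarrow> binary_entropy p + \<bar>L\<bar> * 0"
      by (intro tendsto_intros lim_1_over_n)
    then have "\<forall>\<^sub>F n::nat in sequentially. binary_entropy p + \<bar>L\<bar> * (1 / n) < c"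
      using c by (intro order_tendstoD) auto
    then show "\<forall>\<^sub>F n in sequentially. log 2 (card (typical_class p n)) / n < c"
      using eventually_ge_at_top[of 1]
    proof eventually_elim
      case (elim n) then show ?case using up[of n] by linarith
    qed
  next
    fix c assume c: "c < binary_entropy p"
    define \<eta> where "\<eta> = (binary_entropy p - c) / 2"
    have \<eta>: "\<eta> > 0" using c by (simp add: \<eta>_def)
    obtain r where r: "r > 0" and ev: "\<forall>\<^sub>F n in sequentially. \<forall>A S. A \<subseteq> blocks n \<longrightarrow> S \<subseteq> blocks n \<longrightarrow>
       (\<forall>x\<in>S. \<exists>y\<in>A. hamming_dist n y x \<le> r) \<longrightarrow> measure_pmf.prob (replicate_pmf n P) S \<ge> 1 / 2 \<longrightarrow>
       card A \<ge> 2 powr (n * (binary_entropy p - \<eta>))"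
      by (rule covering_card[OF p P \<eta>])
    \<comment> \<open>The covering radius r is split into r/2 for the deviation of the block's type
      and r/2 for the rounding error 1/n.\<close>
    have "\<forall>\<^sub>F n in sequentially.
      measure_pmf.prob (replicate_pmf n P) {x \<in> blocks n. \<bar>zero_freq n x - p\<bar> \<ge> r / 2} \<le> 1 / 2"
      using r by (intro eventually_concentrated[OF P]) auto
    moreover have "\<forall>\<^sub>F n::nat in sequentially. 1 / n < r / 2"
      using lim_1_over_n[where 'a = real] r by (intro order_tendstoD) auto
    ultimately show "\<forall>\<^sub>F n in sequentially. c < log 2 (card (typical_class p n)) / n"
      using ev eventually_ge_at_top[of 1]
    proof eventually_elim
      case (elim n)
      let ?B = "{x \<in> blocks n. \<bar>zero_freq n x - p\<bar> \<ge> r / 2}"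
      let ?S = "blocks n - ?B"
      have "measure_pmf.prob (replicate_pmf n P) (blocks n) = measure_pmf.prob (replicate_pmf n P) ?S + measure_pmf.prob (replicate_pmf n P) ?B"
        by (subst measure_pmf.finite_measure_Union[symmetric]) (auto intro: arg_cong[where f = "measure_pmf.prob _"])
      then have pr: "measure_pmf.prob (replicate_pmf n P) ?S \<ge> 1 / 2" using elim(1) by (simp add: prob_blocks)
      have cov: "\<forall>x\<in>?S. \<exists>y\<in>typical_class p n. hamming_dist n y x \<le> r"
      proof
        fix x assume x: "x \<in> ?S"
        then obtain y where "y \<in> typical_class p n" "hamming_dist n y x \<le> \<bar>zero_freq n x - p\<bar> + 1 / n"
          using typical_neighbour[of p n x] p elim(4) by auto
        then show "\<exists>y\<in>typical_class p n. hamming_dist n y x \<le> r" using x elim(2) by force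
      qed
      have "card (typical_class p n) \<ge> 2 powr (n * (binary_entropy p - \<eta>))"
        by (rule elim(3)[rule_format, OF typical_class_subset _ _ pr]) (use cov in auto)
      then have "log 2 (card (typical_class p n)) \<ge> n * (binary_entropy p - \<eta>)"
        using pos[OF elim(4)] by (subst le_log_iff) auto
      then have "binary_entropy p - \<eta> \<le> log 2 (card (typical_class p n)) / n"
        using elim(4) by (simp add: le_divide_eq mult.commute)
      then show ?case using c unfolding \<eta>_def by argo
    qed
  qed
qed

section \<open>From codes to achievable rates\<close>

text \<open>The receiver is built with image exactly \<open>C n\<close>. By \<open>near\<close>,
  every optimal word for a typical block is close to it, so any best response, including a worst
  one, has small error. By \<open>truthful\<close>, each codeword is recovered as itself, so the
  recovered image is all of \<open>C n\<close> and the rate is that of the code.\<close>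

lemma achievable_of_codes:
  fixes U :: "bit \<Rightarrow> bit \<Rightarrow> real" and P :: "bit pmf" and C :: "nat \<Rightarrow> bit list set"
  assumes P: "pmf P 0 = p" and K: "K \<ge> 0"
    and C: "\<And>n. n \<ge> 1 \<Longrightarrow> C n \<subseteq> blocks n" "\<And>n. n \<ge> 1 \<Longrightarrow> C n \<noteq> {}"
    and near: "\<And>n x y. n \<ge> 1 \<Longrightarrow> x \<in> blocks n \<Longrightarrow> y \<in> C n \<Longrightarrow>
      (\<And>y'. y' \<in> C n \<Longrightarrow> block_utility U n y' x \<le> block_utility U n y x) \<Longrightarrow>
      hamming_dist n y x \<le> K * (\<bar>zero_freq n x - p\<bar> + 1 / n)"
    and truthful: "\<And>n x y. n \<ge> 1 \<Longrightarrow> x \<in> C n \<Longrightarrow> y \<in> C n \<Longrightarrow>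
      block_utility U n x x \<le> block_utility U n y x \<Longrightarrow> y = x"
    and rate: "(\<lambda>n. log 2 (card (C n)) / n) \<longlonglongrightarrow> R"
  shows "achievable U P 0 R"
proof -
  \<comment> \<open>The exponent makes t n tend to 0 while n (t n)^2 = n^(1/3) tends to infinity.
    The summand 1/n in \<open>\<epsilon>\<close> below makes the error bound strict.\<close>
  define t where "t n = real n powr (- 1 / 3)" for n
  define \<delta> where "\<delta> n = K * (t n + 1 / real n)" for n
  define \<epsilon> where "\<epsilon> n = 2 * exp (- 2 * real n * (t n)\<^sup>2) + 1 / real n" for n
  \<comment> \<open>Codewords are fixed and every other message is decoded to some codeword, so
    nothing outside \<open>C n\<close> can be produced.\<close>
  define g where "g n = (\<lambda>x\<in>blocks n. if x \<in> C n then x else (SOME c. c \<in> C n))" for n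
  define s where "s n = (SOME s. s \<in> worst_responses U P n (\<delta> n) (g n))" for n
  have some: "(SOME c. c \<in> C n) \<in> C n" if "n \<ge> 1" for n using C(2)[OF that] by (simp add: some_in_eq)
  have g: "g n \<in> strategies n" if "n \<ge> 1" for n
    using some[OF that] C(1)[OF that] by (auto simp: g_def strategies_def)
  have img: "g n ` blocks n = C n" if "n \<ge> 1" for n
    using some[OF that] C(1)[OF that] by (auto simp: g_def image_iff split: if_splits)
  have s: "s n \<in> worst_responses U P n (\<delta> n) (g n)" if "n \<ge> 1" for n
    unfolding s_def using worst_responses_nonempty[OF g[OF that]] by (simp add: some_in_eq)
  have sb: "s n \<in> best_responses U n (g n)" if "n \<ge> 1" for n
    using s[OF that] worst_response_iff[OF g[OF that]] by blast
  have im: "g n (s n x) \<in> C n" if "n \<ge> 1" "x \<in> blocks n" for n x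
    using strategies_of_best[OF sb] that img[OF that(1)] by (force simp: strategies_def)
  have opt: "block_utility U n y x \<le> block_utility U n (g n (s n x)) x"
    if "n \<ge> 1" "x \<in> blocks n" "y \<in> C n" for n x y
    using sb[OF that(1)] that img[OF that(1)] by (simp add: best_response_iff[OF g])
  have close: "hamming_dist n (g n (s n x)) x \<le> K * (\<bar>zero_freq n x - p\<bar> + 1 / n)" if "n \<ge> 1" "x \<in> blocks n" for n x
    using near[OF that im[OF that] opt[OF that]] .
  have \<delta>0: "\<delta> n \<ge> 0" for n using K by (simp add: \<delta>_def t_def)
  have fixed: "g n (s n x) = x" if "n \<ge> 1" "x \<in> C n" for n x
    using that C(1)[OF that(1)] by (intro truthful[OF that im opt]) auto
  have error: "error_prob P n (\<delta> n) (g n) (s n) < \<epsilon> n" if n: "n \<ge> 1" for n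
  proof -
    let ?B = "{x \<in> blocks n. \<bar>zero_freq n x - p\<bar> \<ge> t n}"
    have "blocks n \<subseteq> ?B \<union> recovered_set n (\<delta> n) (g n) (s n)"
    proof
      fix x :: "bit list" assume x: "x \<in> blocks n"
      have "K * (\<bar>zero_freq n x - p\<bar> + 1 / n) \<le> \<delta> n" if "\<bar>zero_freq n x - p\<bar> \<le> t n"
        unfolding \<delta>_def using that K by (intro mult_left_mono) auto
      then show "x \<in> ?B \<union> recovered_set n (\<delta> n) (g n) (s n)"
        using close[OF n x] x by (force simp: recovered_set_def)
    qed
    then have "1 \<le> measure_pmf.prob (replicate_pmf n P) (?B \<union> recovered_set n (\<delta> n) (g n) (s n))"
      unfolding prob_blocks[of n P, symmetric] by (intro measure_pmf.finite_measure_mono) auto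
    also have "\<dots> \<le> measure_pmf.prob (replicate_pmf n P) ?B
        + measure_pmf.prob (replicate_pmf n P) (recovered_set n (\<delta> n) (g n) (s n))"
      by (rule measure_Un_le) auto
    also have "measure_pmf.prob (replicate_pmf n P) ?B \<le> 2 * exp (- 2 * real n * (t n)\<^sup>2)"
      by (rule zero_freq_concentration[OF P n]) (simp add: t_def)
    finally have "error_prob P n (\<delta> n) (g n) (s n) \<le> 2 * exp (- 2 * real n * (t n)\<^sup>2)"
      by (simp add: error_prob_def)
    moreover have "1 / real n > 0" using n by simp
    ultimately show ?thesis unfolding \<epsilon>_def by linarith
  qed
  have image: "recovered_image n (\<delta> n) (g n) (s n) = C n" if n: "n \<ge> 1" for n
  proof
    show "recovered_image n (\<delta> n) (g n) (s n) \<subseteq> C n"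
      unfolding recovered_image_def img[OF n] by blast
    show "C n \<subseteq> recovered_image n (\<delta> n) (g n) (s n)"
    proof
      fix x assume x: "x \<in> C n"
      then have "x \<in> recovered_set n (\<delta> n) (g n) (s n)"
        using C(1)[OF n] fixed[OF n x] \<delta>0 by (auto simp: recovered_set_def hamming_dist_self)
      then show "x \<in> recovered_image n (\<delta> n) (g n) (s n)"
        using x fixed[OF n x] unfolding recovered_image_def img[OF n] by blast
    qed
  qed
  have "(\<lambda>n. t n + 1 / real n) \<longlonglongrightarrow> 0" unfolding t_def by real_asymp
  then have lim_\<delta>: "\<delta> \<longlonglongrightarrow> 0" unfolding \<delta>_def by (intro tendsto_mult_right_zero)
  have lim_\<epsilon>: "\<epsilon> \<longlonglongrightarrow> 0" unfolding \<epsilon>_def t_def by real_asymp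
  have "\<forall>\<^sub>F n in sequentially. log 2 (card (C n)) / n = rate n (\<delta> n) (g n) (s n)"
    using eventually_ge_at_top[of 1] by eventually_elim (simp add: rate_def image)
  with rate have "(\<lambda>n. rate n (\<delta> n) (g n) (s n)) \<longlonglongrightarrow> R" by (rule Lim_transform_eventually)
  then show ?thesis
    unfolding achievable_def add_0_left using g s error lim_\<epsilon> lim_\<delta> by blast
qed

text \<open>All words z of the class have the same offset \<open>D\<close> in zero frequency from x,
  so \<open>missed n x z\<close> determines both quantities: distance increases with it and, the sum
  being negative, utility decreases. Comparison with a nearby typical word gives \<open>near\<close>
  with K = 1, and comparison with x itself gives \<open>truthful\<close>.\<close>

lemma achievable_entropy:
  fixes U :: "bit \<Rightarrow> bit \<Rightarrow> real" and P :: "bit pmf"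
  assumes p: "0 < p" "p < 1" and P: "pmf P 0 = p"
    and U: "U 0 0 = 0" "U 1 1 = 0" and sum: "U 0 1 + U 1 0 < 0"
  shows "achievable U P 0 (binary_entropy p)"
proof -
  have closer: "hamming_dist n y x \<le> hamming_dist n y' x"
    if y: "y \<in> typical_class p n" "y' \<in> typical_class p n"
      and le: "block_utility U n y' x \<le> block_utility U n y x" for n x y y'
  proof -
    define D where "D = typical_zeros p n / n - zero_freq n x"
    have "missed n z x = missed n x z + D" if "z \<in> typical_class p n" for z
      using zero_freq_diff[of n z x] zero_freq_typical[OF that] by (simp add: D_def)
    then have "block_utility U n z x = (U 0 1 + U 1 0) * missed n x z + U 0 1 * D"
        "hamming_dist n z x = 2 * missed n x z + D" if "z \<in> typical_class p n" for z
      using that by (simp_all add: block_utility_missed[of U, OF U] hamming_dist_missed algebra_simps)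
    then have "(U 0 1 + U 1 0) * missed n x y' \<le> (U 0 1 + U 1 0) * missed n x y"
      "hamming_dist n y x = 2 * missed n x y + D" "hamming_dist n y' x = 2 * missed n x y' + D"
      using y le by auto
    then show ?thesis using sum by simp
  qed
  show ?thesis
  proof (rule achievable_of_codes[OF P, where K = 1 and C = "typical_class p"])
    fix n x y assume n: "(n::nat) \<ge> 1" and x: "x \<in> blocks n" and y: "y \<in> typical_class p n"
      and opt: "\<And>y'. y' \<in> typical_class p n \<Longrightarrow> block_utility U n y' x \<le> block_utility U n y x"
    obtain y' where "y' \<in> typical_class p n" "hamming_dist n y' x \<le> \<bar>zero_freq n x - p\<bar> + 1 / n"
      using typical_neighbour[of p n x] p n x by auto
    then show "hamming_dist n y x \<le> 1 * (\<bar>zero_freq n x - p\<bar> + 1 / n)"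
      using closer[OF y _ opt] by fastforce
  next
    fix n x y assume n: "(n::nat) \<ge> 1" and x: "x \<in> typical_class p n" and y: "y \<in> typical_class p n"
      and le: "block_utility U n x x \<le> block_utility U n y x"
    have "hamming_dist n y x \<le> 0" using closer[OF y x le] by (simp add: hamming_dist_self)
    then show "y = x" using n x y typical_class_subset by (intro hamming_dist_eq_0) auto
  qed (use p typical_class_subset typical_class_nonempty typical_class_rate in auto)
qed

text \<open>The loss of utility lies between \<open>lo\<close> and \<open>hi\<close> times the
  distance. Hence any code containing the typical class satisfies \<open>near\<close> with K =
  hi/lo, and exact recovery is the unique optimum at codewords. The class can therefore be padded
  with arbitrary words until the rate is R.\<close>

lemma achievable_all:
  fixes U :: "bit \<Rightarrow> bit \<Rightarrow> real" and P :: "bit pmf"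
  assumes p: "0 < p" "p < 1" and P: "pmf P 0 = p"
    and U: "U 0 0 = 0" "U 1 1 = 0" and neg: "U 0 1 < 0" "U 1 0 < 0"
    and R: "binary_entropy p \<le> R" "R \<le> 1"
  shows "achievable U P 0 R"
proof -
  define lo hi where "lo = min (- U 0 1) (- U 1 0)" and "hi = max (- U 0 1) (- U 1 0)"
  have lo: "lo > 0" and hi: "hi > 0" using neg by (auto simp: lo_def hi_def)
  have util: "block_utility U n y x \<le> - lo * hamming_dist n y x"
    "- hi * hamming_dist n y x \<le> block_utility U n y x" for n y x
  proof -
    have "U 0 1 * missed n y x \<le> - lo * missed n y x" "U 1 0 * missed n x y \<le> - lo * missed n x y"
      "- hi * missed n y x \<le> U 0 1 * missed n y x" "- hi * missed n x y \<le> U 1 0 * missed n x y"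
      by (intro mult_right_mono missed_nonneg; simp add: lo_def hi_def)+
    then show "block_utility U n y x \<le> - lo * hamming_dist n y x"
      "- hi * hamming_dist n y x \<le> block_utility U n y x"
      by (simp_all add: block_utility_missed[of U, OF U] hamming_dist_missed algebra_simps)
  qed
  have R0: "R > 0" using R binary_entropy_pos[OF p] by simp
  \<comment> \<open>The maximum leaves room for the whole type class even where the floor is
    smaller; in the limit the rate is max(H(p), R) = R.\<close>
  define m where "m n = max (card (typical_class p n)) (nat \<lfloor>2 powr (n * R)\<rfloor>)" for n
  have m_le: "m n \<le> card (blocks n :: bit list set)" for n
  proof -
    have "2 powr (n * R) \<le> 2 powr real n" using R by (intro powr_mono) (auto intro: mult_left_le)
    also have "\<dots> = real (2 ^ n)" by (simp add: powr_realpow)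
    finally have "\<lfloor>2 powr (n * R)\<rfloor> \<le> int (2 ^ n)" by linarith
    then have "nat \<lfloor>2 powr (n * R)\<rfloor> \<le> 2 ^ n" by linarith
    then show ?thesis using card_mono[OF finite_blocks typical_class_subset[of p n]]
      by (simp add: m_def card_blocks_bit)
  qed
  have "\<exists>C. typical_class p n \<subseteq> C \<and> C \<subseteq> blocks n \<and> card C = m n" for n
    using exists_subset_between[OF _ m_le typical_class_subset finite_blocks, of p n] by (auto simp: m_def)
  then obtain C where C: "\<And>n. typical_class p n \<subseteq> C n" "\<And>n. C n \<subseteq> blocks n" "\<And>n. card (C n) = m n"
    by metis
  show ?thesis
  proof (rule achievable_of_codes[OF P, where K = "hi / lo" and C = C])
    fix n x y assume n: "(n::nat) \<ge> 1" and x: "x \<in> blocks n" and y: "y \<in> C n"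
      and opt: "\<And>y'. y' \<in> C n \<Longrightarrow> block_utility U n y' x \<le> block_utility U n y x"
    obtain y' where y': "y' \<in> typical_class p n" "hamming_dist n y' x \<le> \<bar>zero_freq n x - p\<bar> + 1 / n"
      using typical_neighbour[of p n x] p n x by auto
    have "lo * hamming_dist n y x \<le> hi * hamming_dist n y' x"
      using opt[of y'] y' C(1) util(1)[of n y x] util(2)[of n y' x] by force
    also have "\<dots> \<le> hi * (\<bar>zero_freq n x - p\<bar> + 1 / n)" using y'(2) hi by simp
    finally show "hamming_dist n y x \<le> hi / lo * (\<bar>zero_freq n x - p\<bar> + 1 / n)"
      using lo by (simp add: le_divide_eq mult.commute)
  next
    fix n x y assume n: "(n::nat) \<ge> 1" and x: "x \<in> C n" and y: "y \<in> C n"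
      and le: "block_utility U n x x \<le> block_utility U n y x"
    have "lo * hamming_dist n y x \<le> 0"
      using le util(1)[of n y x] util(2)[of n x x] by (simp add: hamming_dist_self)
    then have "hamming_dist n y x \<le> 0" using lo by (simp add: mult_le_0_iff)
    then show "y = x" using n x y C(2) by (intro hamming_dist_eq_0) auto
  next
    have tc: "card (typical_class p n) > 0" if "n \<ge> 1" for n
      using typical_class_nonempty[of p n] p that finite_subset[OF typical_class_subset finite_blocks]
      by (simp add: card_gt_0_iff)
    define f where "f n = nat \<lfloor>2 powr (n * R)\<rfloor>" for n :: nat
    \<comment> \<open>As the power is at least 1, taking the floor loses at most a factor 2, which
      costs 1/n in the rate.\<close>
    have f1: "2 powr (n * R) \<ge> 1" for n :: nat using R0 by (simp add: ge_one_powr_ge_zero)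
    have fb: "real (f n) \<le> 2 powr (n * R)" "2 powr (n * R) \<le> 2 * real (f n)" "f n > 0" for n
    proof -
      have "\<lfloor>2 powr (n * R)\<rfloor> \<ge> 1" using f1[of n] by (simp add: le_floor_iff)
      then show "real (f n) \<le> 2 powr (n * R)" "2 powr (n * R) \<le> 2 * real (f n)" "f n > 0"
        unfolding f_def by linarith+
    qed
    have lim_f: "(\<lambda>n. log 2 (f n) / n) \<longlonglongrightarrow> R"
    proof (rule tendsto_sandwich)
      have lo_f: "R - 1 / n \<le> log 2 (f n) / n" "log 2 (f n) / n \<le> R" if "n \<ge> 1" for n
      proof -
        have "log 2 (f n) \<le> n * R" using fb[of n] by (subst log_le_iff) auto
        then show "log 2 (f n) / n \<le> R" using that by (simp add: divide_le_eq mult.commute)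
        have "n * R \<le> log 2 (2 * real (f n))" using fb[of n] by (subst le_log_iff) auto
        also have "\<dots> = 1 + log 2 (f n)" using fb(3)[of n] by (simp add: log_mult)
        finally have "(n * R - 1) / n \<le> log 2 (f n) / n" by (intro divide_right_mono) auto
        then show "R - 1 / n \<le> log 2 (f n) / n" using that by (simp add: diff_divide_distrib)
      qed
      show "\<forall>\<^sub>F n in sequentially. R - 1 / n \<le> log 2 (f n) / n"
        "\<forall>\<^sub>F n in sequentially. log 2 (f n) / n \<le> R"
        using eventually_ge_at_top[of 1] lo_f by (fastforce elim: eventually_mono)+
      show "(\<lambda>n. R - 1 / real n) \<longlonglongrightarrow> R" by real_asymp
    qed auto
    have "(\<lambda>n. max (log 2 (card (typical_class p n)) / n) (log 2 (f n) / n)) \<longlonglongrightarrow> max (binary_entropy p) R"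
      by (intro tendsto_max typical_class_rate[OF p] lim_f)
    then have "(\<lambda>n. max (log 2 (card (typical_class p n)) / n) (log 2 (f n) / n)) \<longlonglongrightarrow> R"
      using R by (simp add: max_absorb2)
    moreover have "\<forall>\<^sub>F n in sequentially.
      max (log 2 (card (typical_class p n)) / n) (log 2 (f n) / n) = log 2 (card (C n)) / n"
      using eventually_ge_at_top[of 1]
    proof eventually_elim
      case (elim n)
      have mono: "log 2 (real i) / n \<le> log 2 (real j) / n" if "0 < i" "i \<le> j" for i j :: nat
        using that by (intro divide_right_mono) auto
      show ?case
        using mono[of "card (typical_class p n)" "f n"] mono[of "f n" "card (typical_class p n)"]
          tc[OF elim] fb(3)[of n] by (auto simp: C(3) m_def f_def[symmetric] max_def)
    qed
    ultimately show "(\<lambda>n. log 2 (card (C n)) / n) \<longlonglongrightarrow> R" by (rule Lim_transform_eventually)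
  next
    fix n :: nat assume "n \<ge> 1"
    then show "C n \<noteq> {}" using typical_class_nonempty[of p n] p C(1)[of n] by auto
  qed (use C(2) lo hi in auto)
qed

section \<open>Utilities of mixed sign\<close>

text \<open>Writing a (Z(y) - Z(x)) in one-sided errors leaves (b - a) \<open>missed n x y\<close>,
  which is at most (b - a) Z(x). The right side is the utility of y for x if U(0,1) = a and U(1,0) =
  -b, and that of x for y under the opposite signs.\<close>

lemma weighted_zero_freq_le:
  assumes "a \<le> b"
  shows "a * zero_freq n y - b * zero_freq n x \<le> a * missed n y x - b * missed n x y"
proof -
  have "(b - a) * missed n x y \<le> (b - a) * zero_freq n x"
    using assms by (intro mult_left_mono missed_le_zero_freq) simp
  moreover have "a * missed n y x = a * (missed n x y + zero_freq n y - zero_freq n x)"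
    using zero_freq_diff[of n y x] by simp
  ultimately show ?thesis by (simp add: algebra_simps)
qed

text \<open>A block recovered up to d yields utility at most a d, whereas a word with too many zeros
  would offer more. The argument covers every word of the image, recovered or not, as
  \<open>large_image_error\<close> requires.\<close>

lemma zero_freq_image_le:
  fixes U :: "bit \<Rightarrow> bit \<Rightarrow> real"
  assumes U: "U 0 0 = 0" "U 1 1 = 0" "U 0 1 = a" "U 1 0 = - b" and ab: "0 \<le> a" "a \<le> b"
    and g: "g \<in> strategies n" and s: "s \<in> best_responses U n g"
    and x: "x \<in> recovered_set n d g s" and y: "y \<in> g ` blocks n"
  shows "a * zero_freq n y \<le> b * zero_freq n x + a * d"
proof -
  let ?y = "g (s x)"
  have xb: "x \<in> blocks n" and dist: "hamming_dist n ?y x \<le> d" using x by (auto simp: recovered_set_def)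
  have "a * zero_freq n y - b * zero_freq n x \<le> block_utility U n y x"
    using weighted_zero_freq_le[OF ab(2), of n y x] U by (simp add: block_utility_missed[of U, OF U(1,2)])
  also have "\<dots> \<le> block_utility U n ?y x" using s xb y by (auto simp: best_response_iff[OF g])
  also have "\<dots> \<le> a * missed n ?y x"
    using U ab missed_nonneg[of n x ?y] by (simp add: block_utility_missed[of U, OF U(1,2)])
  also have "\<dots> \<le> a * d"
    using dist missed_nonneg[of n x ?y] ab by (intro mult_left_mono) (auto simp: hamming_dist_missed)
  finally show ?thesis by simp
qed

text \<open>Under the opposite signs the comparison takes place at a block z recovered as y, against
  the word w of x; hence y is taken from the recovered image. The constant 2 a + b collects a d from
  optimality, a d for passing from z to y and b d from w to x.\<close>

lemma zero_freq_recovered_image_le: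
  fixes U :: "bit \<Rightarrow> bit \<Rightarrow> real"
  assumes U: "U 0 0 = 0" "U 1 1 = 0" and ab: "0 \<le> a" "a \<le> b"
    and signs: "U 0 1 = a \<and> U 1 0 = - b \<or> U 0 1 = - b \<and> U 1 0 = a"
    and g: "g \<in> strategies n" and s: "s \<in> best_responses U n g"
    and x: "x \<in> recovered_set n d g s" and y: "y \<in> recovered_image n d g s"
  shows "a * zero_freq n y \<le> b * zero_freq n x + (2 * a + b) * d"
proof -
  have d: "d \<ge> 0" using x hamming_dist_nonneg[of n "g (s x)" x] by (auto simp: recovered_set_def)
  have yg: "y \<in> g ` blocks n" using y by (auto simp: recovered_image_def)
  from signs show ?thesis
  proof
    assume "U 0 1 = a \<and> U 1 0 = - b"
    then have "a * zero_freq n y \<le> b * zero_freq n x + a * d"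
      using zero_freq_image_le[OF U _ _ ab g s x yg] by simp
    moreover have "a * d \<ge> 0" "b * d \<ge> 0" using ab d by auto
    ultimately show ?thesis by (simp add: algebra_simps)
  next
    assume U': "U 0 1 = - b \<and> U 1 0 = a"
    obtain z where z: "z \<in> recovered_set n d g s" "g (s z) = y" using y by (auto simp: recovered_image_def)
    have zb: "z \<in> blocks n" and yz: "hamming_dist n y z \<le> d" using z by (auto simp: recovered_set_def)
    define w where "w = g (s x)"
    have xb: "x \<in> blocks n" and wx: "hamming_dist n w x \<le> d" using x by (auto simp: recovered_set_def w_def)
    have w: "w \<in> g ` blocks n" using strategies_of_best[OF s] xb by (auto simp: w_def strategies_def)
    have "a * zero_freq n z - b * zero_freq n w \<le> block_utility U n w z"
      using weighted_zero_freq_le[OF ab(2), of n z w] U' by (simp add: block_utility_missed[of U, OF U])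
    also have "\<dots> \<le> block_utility U n y z" using s zb w z(2) by (auto simp: best_response_iff[OF g])
    also have "\<dots> \<le> a * missed n z y"
      using U' ab missed_nonneg[of n y z] by (simp add: block_utility_missed[of U, OF U])
    also have "\<dots> \<le> a * d"
      using yz missed_nonneg[of n y z] ab by (intro mult_left_mono) (auto simp: hamming_dist_missed)
    finally have 1: "a * zero_freq n z \<le> b * zero_freq n w + a * d" by simp
    have close: "zero_freq n u \<le> zero_freq n v + d" if "hamming_dist n u v \<le> d" for u v
      using that zero_freq_diff[of n u v] missed_nonneg[of n v u] by (simp add: hamming_dist_missed)
    have "a * zero_freq n y \<le> a * (zero_freq n z + d)" "b * zero_freq n w \<le> b * (zero_freq n x + d)"
      using close[OF yz] close[OF wx] ab by (auto intro: mult_left_mono)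
    with 1 show ?thesis by (simp add: algebra_simps)
  qed
qed

section \<open>Upper bound on rates, and failure for oversized images\<close>

lemma slack:
  fixes a b p q :: real
  assumes "0 < a" "a \<le> b" "b / a * p < q"
  obtains \<tau> where "\<tau> > 0" "\<And>z d. z \<le> p + \<tau> \<Longrightarrow> d \<le> \<tau> \<Longrightarrow> b * z + (2 * a + b) * d < a * q"
proof -
  \<comment> \<open>At the extreme values z = p + \<tau> and d = \<tau> the excess over b p is 2 (a
    + b) \<tau>, which this choice makes half of the gap a q - b p.\<close>
  define \<tau> where "\<tau> = (a * q - b * p) / (4 * (a + b))"
  have gap: "a * q - b * p > 0" using assms by (simp add: field_simps)
  show thesis
  proof (rule that[of \<tau>])
    show "\<tau> > 0" using gap assms by (simp add: \<tau>_def)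
    fix z d assume z: "z \<le> p + \<tau>" and d: "d \<le> \<tau>"
    have "b * z + (2 * a + b) * d \<le> b * (p + \<tau>) + (2 * a + b) * \<tau>"
      using z d assms by (intro add_mono mult_left_mono) auto
    also have "\<dots> = b * p + 2 * (a + b) * \<tau>" by (simp add: algebra_simps)
    also have "2 * (a + b) * \<tau> = (a * q - b * p) / 2" using assms by (simp add: \<tau>_def field_simps)
    finally show "b * z + (2 * a + b) * d < a * q" using gap by argo
  qed
qed

lemma achievable_upper:
  fixes U :: "bit \<Rightarrow> bit \<Rightarrow> real" and P :: "bit pmf"
  assumes p: "0 < p" "p < 1" and P: "pmf P 0 = p"
    and U: "U 0 0 = 0" "U 1 1 = 0" and ab: "0 \<le> a" "a \<le> b" and b: "0 < b"
    and signs: "U 0 1 = a \<and> U 1 0 = - b \<or> U 0 1 = - b \<and> U 1 0 = a"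
    and R: "achievable U P 0 R"
  shows "R \<le> binary_entropy (scaled_prob a b p)"
\<comment> \<open>Without this condition the claimed bound is H(1/2) = 1, which
  \<open>achievable_le_1\<close> already gives.\<close>
proof (cases "a > 0 \<and> b / a * p < 1 / 2")
  case False
  then have "scaled_prob a b p = 1 / 2" using ab by (auto simp: scaled_prob_def)
  then have "binary_entropy (scaled_prob a b p) = 1" by (simp only: binary_entropy_half)
  then show ?thesis using achievable_le_1[OF R] by simp
next
  case True
  define q0 where "q0 = b / a * p"
  have q0: "0 < q0" "q0 < 1 / 2" using True p b by (auto simp: q0_def)
  have sc: "scaled_prob a b p = q0" using True by (auto simp: scaled_prob_def q0_def)
  obtain g s \<delta> \<epsilon> where "\<forall>n\<ge>1. g n \<in> strategies n" "\<forall>n\<ge>1. s n \<in> best_responses U n (g n)"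
      "\<forall>n\<ge>1. error_prob P n (\<delta> n) (g n) (s n) = worst_error U P n (\<delta> n) (g n)"
      "\<forall>n\<ge>1. error_prob P n (\<delta> n) (g n) (s n) < \<epsilon> n"
    and lims: "\<epsilon> \<longlonglongrightarrow> 0" "\<delta> \<longlonglongrightarrow> 0" and lim: "(\<lambda>n. rate n (\<delta> n) (g n) (s n)) \<longlonglongrightarrow> R"
    by (rule achievableE[OF R])
  note g = this(1)[rule_format] and s = this(2)[rule_format] and err = this(4)[rule_format]
  have bound: "R \<le> binary_entropy q" if q: "q0 < q" "q < 1 / 2" for q
  proof -
    obtain \<tau> where \<tau>: "\<tau> > 0" and sl: "\<And>z d. z \<le> p + \<tau> \<Longrightarrow> d \<le> \<tau> \<Longrightarrow> b * z + (2 * a + b) * d < a * q"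
      using slack[of a b p q] True ab q unfolding q0_def by metis
    have "\<forall>\<^sub>F n in sequentially. \<epsilon> n < 1 / 2" using lims(1) by (rule order_tendstoD) simp
    moreover have "\<forall>\<^sub>F n in sequentially. \<delta> n < \<tau>" using lims(2) \<tau> by (rule order_tendstoD)
    moreover have "\<forall>\<^sub>F n in sequentially.
        measure_pmf.prob (replicate_pmf n P) {x \<in> blocks n. \<bar>zero_freq n x - p\<bar> \<ge> \<tau>} \<le> 1 / 2"
      using \<tau> by (intro eventually_concentrated[OF P]) auto
    ultimately have "\<forall>\<^sub>F n in sequentially. rate n (\<delta> n) (g n) (s n) \<le> binary_entropy q"
      using eventually_ge_at_top[of 1]
    proof eventually_elim
      case (elim n)
      let ?D = "recovered_set n (\<delta> n) (g n) (s n)" and ?B = "{x \<in> blocks n. \<bar>zero_freq n x - p\<bar> \<ge> \<tau>}"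
      have "measure_pmf.prob (replicate_pmf n P) ?D > 1 / 2"
        using err[OF elim(4)] elim(1) by (simp add: prob_recovered)
      \<comment> \<open>The recovered set has probability above 1/2 and the atypical set at most
        1/2, so some recovered block is typical. This one block bounds the zeros of all recovered
        words.\<close>
      then have "\<not> ?D \<subseteq> ?B"
        using elim(3) measure_pmf.finite_measure_mono[of ?D ?B "replicate_pmf n P"] by auto
      then obtain x where x: "x \<in> ?D" "zero_freq n x \<le> p + \<tau>"
        using recovered_set_subset[of n "\<delta> n" "g n" "s n"] by fastforce
      have "zero_freq n y \<le> q" if y: "y \<in> recovered_image n (\<delta> n) (g n) (s n)" for y
      proof -
        have "a * zero_freq n y \<le> b * zero_freq n x + (2 * a + b) * \<delta> n"
          by (rule zero_freq_recovered_image_le[OF U ab signs g[OF elim(4)] s[OF elim(4)] x(1) y])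
        also have "\<dots> < a * q" using x(2) elim(2) by (intro sl) auto
        finally show ?thesis using True by simp
      qed
      then have sub: "recovered_image n (\<delta> n) (g n) (s n) \<subseteq> {y \<in> blocks n. zero_freq n y \<le> q}"
        using recovered_image_subset[OF g[OF elim(4)]] by blast
      show ?case
      proof (rule rate_le[OF g[OF elim(4)] elim(4) sub])
        show "finite {y \<in> blocks n. zero_freq n y \<le> q}" by (rule finite_subset[OF _ finite_blocks]) auto
        show "card {y \<in> blocks n. zero_freq n y \<le> q} \<le> 2 powr (n * binary_entropy q)"
          using q q0 elim(4) by (intro card_zero_freq_le) auto
        show "0 \<le> binary_entropy q" using binary_entropy_pos[of q] q q0 by simp
      qed
    qed
    then show ?thesis by (rule tendsto_upperbound[OF lim]) simp
  qed
  \<comment> \<open>The comparison needs slack above q0, so the bound is proved for q between q0 and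
    1/2 and passes to q0 by continuity.\<close>
  have "(binary_entropy \<longlongrightarrow> binary_entropy q0) (at_right q0)"
    using isCont_binary_entropy[of q0] q0 by (simp add: isCont_def filterlim_at_split)
  moreover have "\<forall>\<^sub>F q in at_right q0. R \<le> binary_entropy q"
    using eventually_at_right_real[OF q0(2)] by eventually_elim (use bound in auto)
  ultimately have "R \<le> binary_entropy q0" by (rule tendsto_lowerbound) simp
  then show ?thesis by (simp add: sc)
qed

text \<open>An image of more than 2^(n H(q)) words contains one with zero frequency above q. By
  \<open>zero_freq_image_le\<close> no block with frequency at most p + \<tau> is then recovered, so
  every best response fails outside an atypical set.\<close>

lemma large_image_error:
  fixes U :: "bit \<Rightarrow> bit \<Rightarrow> real" and P :: "bit pmf"
  assumes p: "0 < p" "p < 1" and P: "pmf P 0 = p"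
    and U: "U 0 0 = 0" "U 1 1 = 0" "U 0 1 = a" "U 1 0 = - b" and ab: "0 \<le> a" "a \<le> b" and b: "0 < b"
    and g: "\<And>n. n \<ge> 1 \<Longrightarrow> g n \<in> strategies n"
    and lim: "(\<lambda>n. log 2 (real (card (g n ` blocks n))) / real n) \<longlonglongrightarrow> L"
    and L: "L > binary_entropy (scaled_prob a b p)"
  shows "\<forall>\<^sub>F \<delta> in at_right 0. (\<lambda>n. worst_error U P n \<delta> (g n)) \<longlonglongrightarrow> 1"
proof -
  have pos: "card (g n ` blocks n) > 0" for n
    using blocks_nonempty[where 'a = bit] by (simp add: card_gt_0_iff)
  have "\<forall>\<^sub>F n in sequentially. log 2 (real (card (g n ` blocks n))) / real n \<le> 1"
    using eventually_ge_at_top[of 1]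
  proof eventually_elim
    case (elim n)
    have "card (g n ` blocks n) \<le> 2 ^ n"
      using card_image_le[OF finite_blocks, of "g n" n] by (simp add: card_blocks_bit)
    then have "real (card (g n ` blocks n)) \<le> 2 powr n" by (simp add: powr_realpow)
    then have "log 2 (card (g n ` blocks n)) \<le> n" using pos[of n] by (subst log_le_iff) auto
    then show ?case using elim by simp
  qed
  then have L1: "L \<le> 1" by (rule tendsto_upperbound[OF lim]) simp
  \<comment> \<open>Otherwise the entropy bound would be H(1/2) = 1, contradicting L \<le>
    1.\<close>
  have ap: "a > 0 \<and> b / a * p < 1 / 2"
  proof (rule ccontr)
    assume "\<not> (a > 0 \<and> b / a * p < 1 / 2)"
    then have "scaled_prob a b p = 1 / 2" using ab by (auto simp: scaled_prob_def)
    then have "binary_entropy (scaled_prob a b p) = 1" by (simp only: binary_entropy_half)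
    then show False using L L1 by simp
  qed
  define q0 where "q0 = b / a * p"
  have q0: "0 < q0" "q0 < 1 / 2" using ap p b by (auto simp: q0_def)
  have sc: "scaled_prob a b p = q0" using ap by (auto simp: scaled_prob_def q0_def)
  have "(binary_entropy \<longlongrightarrow> binary_entropy q0) (at_right q0)"
    using isCont_binary_entropy[of q0] q0 by (simp add: isCont_def filterlim_at_split)
  then have "\<forall>\<^sub>F q in at_right q0. binary_entropy q < L"
    using L by (intro order_tendstoD) (simp_all add: sc)
  then have "\<forall>\<^sub>F q in at_right q0. binary_entropy q < L \<and> q0 < q \<and> q < 1 / 2"
    using eventually_at_right_real[OF q0(2)] by eventually_elim auto
  then obtain q where q: "binary_entropy q < L" "q0 < q" "q < 1 / 2"
    using eventually_happens'[of "at_right q0"] by auto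
  obtain \<tau> where \<tau>: "\<tau> > 0" and sl: "\<And>z d. z \<le> p + \<tau> \<Longrightarrow> d \<le> \<tau> \<Longrightarrow> b * z + (2 * a + b) * d < a * q"
    using slack[of a b p q] ap ab q unfolding q0_def by metis
  have "(\<lambda>n. worst_error U P n \<delta> (g n)) \<longlonglongrightarrow> 1" if \<delta>: "0 < \<delta>" "\<delta> < \<tau>" for \<delta>
  proof (rule worst_error_tendsto_1[OF g])
    fix e :: real assume e: "e > 0"
    have "\<forall>\<^sub>F n in sequentially.
        measure_pmf.prob (replicate_pmf n P) {x \<in> blocks n. \<bar>zero_freq n x - p\<bar> \<ge> \<tau>} \<le> e"
      using \<tau> e by (intro eventually_concentrated[OF P])
    moreover have "\<forall>\<^sub>F n in sequentially. binary_entropy q < log 2 (real (card (g n ` blocks n))) / real n"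
      using lim q(1) by (rule order_tendstoD)
    ultimately show "\<forall>\<^sub>F n in sequentially. worst_error U P n \<delta> (g n) \<ge> 1 - e"
      using eventually_ge_at_top[of 1]
    proof eventually_elim
      case (elim n)
      have "n * binary_entropy q < log 2 (card (g n ` blocks n))"
        using elim(2,3) by (simp add: less_divide_eq mult.commute)
      then have big: "2 powr (n * binary_entropy q) < card (g n ` blocks n)"
        using pos[of n] by (subst (asm) less_log_iff) auto
      have "\<not> g n ` blocks n \<subseteq> {y \<in> blocks n. zero_freq n y \<le> q}"
      proof
        assume "g n ` blocks n \<subseteq> {y \<in> blocks n. zero_freq n y \<le> q}"
        then have "card (g n ` blocks n) \<le> card {y \<in> blocks n. zero_freq n y \<le> q}"
          by (intro card_mono finite_subset[OF _ finite_blocks]) auto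
        then show False using card_zero_freq_le[of q n] q q0 elim(3) big by simp
      qed
      then obtain y where y: "y \<in> g n ` blocks n" "zero_freq n y > q"
        using strategies_image[OF g[OF elim(3)]] by fastforce
      obtain s where s: "s \<in> best_responses U n (g n)" using best_responses_nonempty[OF g[OF elim(3)]] by blast
      have "recovered_set n \<delta> (g n) s \<subseteq> {x \<in> blocks n. \<bar>zero_freq n x - p\<bar> \<ge> \<tau>}"
      proof
        fix x assume x: "x \<in> recovered_set n \<delta> (g n) s"
        have "a * q < a * zero_freq n y" using y ap by simp
        also have "\<dots> \<le> b * zero_freq n x + a * \<delta>"
          by (rule zero_freq_image_le[OF U ab g[OF elim(3)] s x y(1)])
        also have "\<dots> \<le> b * zero_freq n x + (2 * a + b) * \<delta>" using ab b \<delta> by (simp add: mult_right_mono)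
        finally have "\<not> zero_freq n x \<le> p + \<tau>" using sl[of "zero_freq n x" \<delta>] \<delta> by linarith
        then show "x \<in> {x \<in> blocks n. \<bar>zero_freq n x - p\<bar> \<ge> \<tau>}"
          using x recovered_set_subset[of n \<delta> "g n" s] by auto
      qed
      then have "measure_pmf.prob (replicate_pmf n P) (recovered_set n \<delta> (g n) s)
          \<le> measure_pmf.prob (replicate_pmf n P) {x \<in> blocks n. \<bar>zero_freq n x - p\<bar> \<ge> \<tau>}"
        by (intro measure_pmf.finite_measure_mono) auto
      then have "1 - e \<le> error_prob P n \<delta> (g n) s" using elim(1) by (simp add: prob_recovered)
      also have "\<dots> \<le> worst_error U P n \<delta> (g n)" by (rule error_prob_le_worst[OF s])
      finally show "worst_error U P n \<delta> (g n) \<ge> 1 - e" .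
    qed
  qed
  then show ?thesis using eventually_at_right_real[OF \<tau>] by (auto elim!: eventually_mono)
qed

text \<open>Small enough \<delta> is rendered by \<open>at_right 0\<close>. For a nonnegative sum
  the threshold is common to all receivers; for oversized images it may depend on g, and the proof
  lets it depend only through the limit L.\<close>

theorem mainTheorem1:
  fixes U :: "bit \<Rightarrow> bit \<Rightarrow> real" and P :: "bit pmf" and p a b :: real
  assumes "0 < p" and "p < 1" and "pmf P 0 = p"
    and "U 0 0 = 0" and "U 1 1 = 0"
    and "a = min \<bar>U 0 1\<bar> \<bar>U 1 0\<bar>" and "b = max \<bar>U 0 1\<bar> \<bar>U 1 0\<bar>"
  shows
    "(achievable_rates U P 0 \<noteq> {} \<longleftrightarrow> U 0 1 + U 1 0 < 0) \<and>
     (U 0 1 + U 1 0 \<ge> 0 \<longrightarrow>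
        (\<forall>\<^sub>F \<delta> in at_right 0. \<forall>g. (\<forall>n\<ge>1. g n \<in> strategies n) \<longrightarrow>
           (\<lambda>n. worst_error U P n \<delta> (g n)) \<longlonglongrightarrow> 1)) \<and>
     (U 0 1 + U 1 0 < 0 \<and> (U 0 1 \<ge> 0 \<or> U 1 0 \<ge> 0) \<longrightarrow>
        Inf (achievable_rates U P 0) = binary_entropy p \<and>
        Sup (achievable_rates U P 0) \<le> binary_entropy (scaled_prob a b p) \<and>
        (U 1 0 = - b \<and> U 0 1 = a \<longrightarrow>
           (\<forall>g L. (\<forall>n\<ge>1. g n \<in> strategies n) \<longrightarrow>
              (\<lambda>n. log 2 (real (card (g n ` blocks n))) / real n) \<longlonglongrightarrow> L \<longrightarrow>
              L > binary_entropy (scaled_prob a b p) \<longrightarrow>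
              (\<forall>\<^sub>F \<delta> in at_right 0. (\<lambda>n. worst_error U P n \<delta> (g n)) \<longlonglongrightarrow> 1)))) \<and>
     (U 0 1 < 0 \<and> U 1 0 < 0 \<longrightarrow> achievable_rates U P 0 = {binary_entropy p..1})"
proof (intro conjI impI allI)
  note p = assms(1,2) and P = assms(3) and U = assms(4,5)
  let ?R = "achievable_rates U P 0"
  have lower: "binary_entropy p \<le> R" if "R \<in> ?R" for R
    using achievable_lower[OF p P] that by (simp add: achievable_rates_def)
  have entropy: "binary_entropy p \<in> ?R" if "U 0 1 + U 1 0 < 0"
    using achievable_entropy[of p P U, OF p P U that] by (simp add: achievable_rates_def)
  show "?R \<noteq> {} \<longleftrightarrow> U 0 1 + U 1 0 < 0"
    using entropy achievable_imp_sum_neg[of p P U, OF p P U] by (auto simp: achievable_rates_def)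
  show "\<forall>\<^sub>F \<delta> in at_right 0. \<forall>g. (\<forall>n\<ge>1. g n \<in> strategies n) \<longrightarrow>
           (\<lambda>n. worst_error U P n \<delta> (g n)) \<longlonglongrightarrow> 1" if sum: "U 0 1 + U 1 0 \<ge> 0"
  proof -
    obtain d where d: "d > 0" and low:
      "\<And>e. e > 0 \<Longrightarrow> \<forall>\<^sub>F n in sequentially. \<forall>g\<in>strategies n. \<forall>d'\<le>d. worst_error U P n d' g \<ge> 1 - e"
      using worst_error_near_1[of p P U, OF p P U sum] by blast
    have "(\<lambda>n. worst_error U P n \<delta> (g n)) \<longlonglongrightarrow> 1" if g: "\<forall>n\<ge>1. g n \<in> strategies n" and \<delta>: "\<delta> < d" for \<delta> g
    proof (rule worst_error_tendsto_1)
      fix e :: real assume "e > 0"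
      from low[OF this] eventually_ge_at_top[of 1]
      show "\<forall>\<^sub>F n in sequentially. worst_error U P n \<delta> (g n) \<ge> 1 - e"
        by eventually_elim (use g \<delta> in auto)
    qed (use g in auto)
    then show ?thesis using eventually_at_right_real[OF d] by (auto elim!: eventually_mono)
  qed
  show "Inf ?R = binary_entropy p" if "U 0 1 + U 1 0 < 0 \<and> (U 0 1 \<ge> 0 \<or> U 1 0 \<ge> 0)"
    using that by (intro cInf_eq_minimum entropy lower) auto
  show "Sup ?R \<le> binary_entropy (scaled_prob a b p)"
    if "U 0 1 + U 1 0 < 0 \<and> (U 0 1 \<ge> 0 \<or> U 1 0 \<ge> 0)"
  proof (rule cSup_least)
    show "?R \<noteq> {}" using that entropy by auto
    fix R assume "R \<in> ?R"
    then have R: "achievable U P 0 R" by (simp add: achievable_rates_def)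
    \<comment> \<open>A negative sum forces the nonnegative utility to be the smaller one in
      absolute value, so it equals a and the other equals -b.\<close>
    have "U 0 1 = a \<and> U 1 0 = - b \<or> U 0 1 = - b \<and> U 1 0 = a" "0 \<le> a" "a \<le> b" "0 < b"
      using that assms(6,7) by (auto simp: min_def max_def abs_if split: if_splits)
    then show "R \<le> binary_entropy (scaled_prob a b p)"
      using achievable_upper[of p P U a b, OF p P U _ _ _ _ R] by blast
  qed
  show "\<forall>\<^sub>F \<delta> in at_right 0. (\<lambda>n. worst_error U P n \<delta> (g n)) \<longlonglongrightarrow> 1"
    if "U 0 1 + U 1 0 < 0 \<and> (U 0 1 \<ge> 0 \<or> U 1 0 \<ge> 0)" and sg: "U 1 0 = - b \<and> U 0 1 = a"
      and g: "\<forall>n\<ge>1. g n \<in> strategies n"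
      and lim: "(\<lambda>n. log 2 (real (card (g n ` blocks n))) / real n) \<longlonglongrightarrow> L"
      and L: "L > binary_entropy (scaled_prob a b p)" for g L
  proof -
    have ab: "0 \<le> a" "a \<le> b" "0 < b"
      using that(1) assms(6,7) by (auto simp: min_def max_def abs_if split: if_splits)
    show ?thesis
      by (rule large_image_error[of p P U a b g L, OF p P U _ _ ab _ lim L]) (use sg g in auto)
  qed
  show "?R = {binary_entropy p..1}" if "U 0 1 < 0 \<and> U 1 0 < 0"
    using that lower achievable_le_1 achievable_all[of p P U, OF p P U]
    by (auto simp: achievable_rates_def)
qed

end
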